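(* Let $q=x_0^2+x_1^2+x_2^2+x_3^2$ and $f_0=x_0^4+x_1^4+x_2^4+x_3^4$. For each $\lambda\in\{-1,-\frac12,-\frac13,-\frac14\}$ the nodes of the quartic surface $f_0+\lambda q^2=0$ in $\mathbb{P}_3(\mathbb{C})$ form one orbit under $(OO)'$. The length of the orbit, and the isomorphism type and order of the fix group (stabilizer) of a node in $(OO)'/\{\pm1\}$, are: \[ \begin{array}{l|c|c|c|c} \lambda&-1&-\frac12&-\frac13&-\frac14\\ \hline \text{orbit length}&4&12&16&8\\ \text{fix group mod }\pm1&S_4&D_4&D_3&A_4\\ \text{order}&24&8&6&12 \end{array} \]
   Context: Identify $\mathbb{R}^4$ with the quaternions via $(x_0,x_1,x_2,x_3)\leftrightarrow x_0+x_1 i+x_2 j+x_3 k$. A pair $(g_1,g_2)$ of unit quaternions acts on $\mathbb{R}^4$ by $p\mapsto g_1\,p\,g_2^{-1}$; this gives the double covering $SU(2)\times SU(2)\to SO(4)$. Put $\tilde V=\langle i,j\rangle$ and $\tilde O=\langle i,\frac{1+i}{\sqrt2},\frac12(1+i-j+k)\rangle$ (binary octahedral group, order 48). The group $(OO)'\subset SO(4)$ (order 192) is the image of $\{(p,q)\in\tilde O\times\tilde O: p\tilde V=q\tilde V\}$; it acts on $\mathbb{P}_3(\mathbb{C})$ through $(OO)'/\{\pm1\}$. A node is an ordinary double point. $D_n$ denotes the dihedral group of order $2n$, $S_4$ the symmetric group and $A_4$ the alternating group on four letters. *)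

theory Defs
  imports
    "HOL-Analysis.Analysis"
    "HOL-Algebra.Group_Action"
    "HOL-Algebra.Generated_Groups"
    "HOL-Algebra.Sym_Groups"
begin

section \<open>Quaternions\<close>

text \<open>The index type \<open>4\<close> has the elements \<open>0, 1, 2, 3\<close>, which number the coordinates
  \<open>x\<^sub>0, x\<^sub>1, x\<^sub>2, x\<^sub>3\<close>.\<close>

definition quat :: "real \<Rightarrow> real \<Rightarrow> real \<Rightarrow> real \<Rightarrow> real^4" where
  "quat a b c d = axis 0 a + axis 1 b + axis 2 c + axis 3 d"

definition q_mult :: "real^4 \<Rightarrow> real^4 \<Rightarrow> real^4" where
  "q_mult p q = quat
     (p$0 * q$0 - p$1 * q$1 - p$2 * q$2 - p$3 * q$3)
     (p$0 * q$1 + p$1 * q$0 + p$2 * q$3 - p$3 * q$2)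
     (p$0 * q$2 - p$1 * q$3 + p$2 * q$0 + p$3 * q$1)
     (p$0 * q$3 + p$1 * q$2 - p$2 * q$1 + p$3 * q$0)"

definition unit_quaternions :: "(real^4) monoid" where
  "unit_quaternions = \<lparr>carrier = {p. norm p = 1}, monoid.mult = q_mult, one = quat 1 0 0 0\<rparr>"

definition V_tilde :: "(real^4) set" where
  "V_tilde = generate unit_quaternions {quat 0 1 0 0, quat 0 0 1 0}"

definition O_tilde :: "(real^4) set" where
  "O_tilde = generate unit_quaternions
     {quat 0 1 0 0, quat (1 / sqrt 2) (1 / sqrt 2) 0 0, quat (1/2) (1/2) (-1/2) (1/2)}"

definition quat_rotation :: "real^4 \<Rightarrow> real^4 \<Rightarrow> real^4^4" where
  "quat_rotation g1 g2 = matrix (\<lambda>p. q_mult (q_mult g1 p) (inv\<^bsub>unit_quaternions\<^esub> g2))"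

section \<open>The group \<open>(OO)'\<close> and its action on projective space\<close>

definition OO' :: "(real^4^4) monoid" where
  "OO' = \<lparr>carrier = {quat_rotation p q | p q. p \<in> O_tilde \<and> q \<in> O_tilde \<and>
                       p <#\<^bsub>unit_quaternions\<^esub> V_tilde = q <#\<^bsub>unit_quaternions\<^esub> V_tilde},
          monoid.mult = (**), one = mat 1\<rparr>"

definition P3 :: "(complex^4) set set" where
  "P3 = {L. vec.subspace L \<and> vec.dim L = 1}"

definition complexify :: "real^4^4 \<Rightarrow> complex^4^4" where
  "complexify A = (\<chi> i j. complex_of_real (A $ i $ j))"

definition proj_action :: "real^4^4 \<Rightarrow> (complex^4) set \<Rightarrow> (complex^4) set" where
  "proj_action A = (\<lambda>L\<in>P3. (*v) (complexify A) ` L)"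

abbreviation OO'_mod :: "(real^4^4) set monoid" where
  "OO'_mod \<equiv> OO' Mod {mat 1, - mat 1}"

text \<open>A coset is a pair \<open>{A, -A}\<close>, and both of its members act in the same way on \<open>P3\<close>.\<close>

definition coset_action :: "(real^4^4) set \<Rightarrow> (complex^4) set \<Rightarrow> (complex^4) set" where
  "coset_action C = (\<lambda>L\<in>P3. the_elem ((\<lambda>A. proj_action A L) ` C))"

definition fix_group :: "(complex^4) set \<Rightarrow> (real^4^4) set monoid" where
  "fix_group P = OO'_mod\<lparr>carrier := stabilizer OO'_mod coset_action P\<rparr>"

section \<open>Nodes of the quartic surfaces\<close>

definition q_form :: "complex^4 \<Rightarrow> complex" where
  "q_form x = (\<Sum>i\<in>UNIV. (x $ i)^2)"

definition f0 :: "complex^4 \<Rightarrow> complex" where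
  "f0 x = (\<Sum>i\<in>UNIV. (x $ i)^4)"

definition quartic :: "complex \<Rightarrow> complex^4 \<Rightarrow> complex" where
  "quartic l x = f0 x + l * (q_form x)^2"

definition partial :: "'n::finite \<Rightarrow> (complex^'n \<Rightarrow> complex) \<Rightarrow> complex^'n \<Rightarrow> complex" where
  "partial j g a = deriv (\<lambda>t. g (a + axis j t)) 0"

text \<open>An ordinary double point of an affine hypersurface \<open>g = 0\<close>: multiplicity two and
  nondegenerate quadratic part.\<close>

definition ordinary_double_point :: "(complex^'n::finite \<Rightarrow> complex) \<Rightarrow> complex^'n \<Rightarrow> bool" where
  "ordinary_double_point g a \<longleftrightarrow>
     g a = 0 \<and> (\<forall>j. partial j g a = 0) \<and> det (\<chi> j k. partial j (partial k g) a) \<noteq> 0"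

text \<open>The affine chart \<open>x\<^sub>i = 1\<close>; index arithmetic is modulo 4, so the three remaining coordinates
  are taken in cyclic order.\<close>

definition chart :: "4 \<Rightarrow> complex^3 \<Rightarrow> complex^4" where
  "chart i y = axis i 1 + axis (i + 1) (y $ 0) + axis (i + 2) (y $ 1) + axis (i + 3) (y $ 2)"

text \<open>The argument is a homogeneous form; nondegeneracy does not depend on the chart.\<close>

definition nodes :: "(complex^4 \<Rightarrow> complex) \<Rightarrow> (complex^4) set set" where
  "nodes F = {vec.span {chart i a} | i a. ordinary_double_point (\<lambda>y. F (chart i y)) a}"

section \<open>Dihedral groups\<close>

text \<open>The pair \<open>(a, s)\<close> stands for the rotation \<open>r\<^sup>a\<close> if \<open>s\<close> is false and for \<open>r\<^sup>a\<close> times the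
  basic reflection otherwise; the order is \<open>2n\<close>.\<close>

definition dihedral_group :: "nat \<Rightarrow> (int \<times> bool) monoid" where
  "dihedral_group n = \<lparr>carrier = {0..<int n} \<times> UNIV,
     monoid.mult = (\<lambda>(a, s) (b, t). ((if s then a - b else a + b) mod int n, s \<noteq> t)),
     one = (0, False)\<rparr>"

end

theory Submission
  imports Defs
begin

text \<open>
  The group \<open>(OO)'\<close> consists of the signed permutation matrices of determinant one: right
  multiplications by \<open>V_tilde\<close> and conjugations by \<open>O_tilde\<close> are such matrices, and together they
  realise all even diagonal sign changes and, up to signs, all transpositions.

  The partial derivatives of \<open>f\<^sub>0 + \<lambda> q\<^sup>2\<close> are \<open>4 x\<^sub>i (x\<^sub>i\<^sup>2 + \<lambda> q)\<close>, so at a singular point all nonzero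
  coordinates have the same square. For \<open>\<lambda> = -1/k\<close> the nodes are thus the points with exactly \<open>k\<close>
  coordinates \<open>\<plusminus>1\<close> and the others \<open>0\<close>, and signed permutations act transitively on them.
  By the orbit-stabilizer theorem it suffices to embed a group of the right order into the fix group
  of one node. The embeddings are: permutation matrices for \<open>A\<^sub>4\<close>, explicit generators for the dihedral
  groups, and for \<open>S\<^sub>4\<close> the permutation representation, twisted by the sign character
  on the hyperplane orthogonal to \<open>(1, 1, 1, 1)\<close> and conjugated by a Hadamard matrix.
\<close>

section \<open>Signed permutation matrices\<close>

text \<open>A node is a line, so a matrix in its fix group may reverse the real vector that spans
  it. Modulo \<plusminus>1 this ambiguity disappears: the matrices are orthogonal, so exactly one of
  A and -A fixes the vector itself. Each fix group is therefore a copy of the stabilizer of a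
  vector, and each embedding can be built as a homomorphism into \<open>OO'\<close>, with matrices
  instead of cosets, whose image meets \<plusminus>1 only in the identity. The fix groups are never
  enumerated. There are 24 * 8 = 192 signed permutation matrices of determinant one, so the quotient
  has order 96, and in each column of the table the orbit length times the order of the group is 96;
  an injective map into the fix group is then onto. The determinant shapes the four groups. At (1,
  1, 1, 1) no sign is free, so only even permutations remain. At (1, 1, 1, 0) and (1, 1, 0, 0) a
  sign off the support or a swap within it compensates an odd permutation. At (1, 0, 0, 0) the other
  three coordinates carry the rotations of the cube, which S_4 describes through the four space
  diagonals.\<close>

lemma four_eq_zero: "(4::4) = 0"
  by simp

text \<open>The standard facts for type \<open>4\<close> number its elements 1, 2, 3, 4, where 4 is
  0. These variants use the coordinate numbers 0 to 3 of the quaternions.\<close>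

lemma all4: "(\<forall>i::4. P i) \<longleftrightarrow> P 0 \<and> P 1 \<and> P 2 \<and> P 3"
  by (subst forall_4, subst four_eq_zero) auto

lemma sum4: "sum f (UNIV::4 set) = f 0 + f 1 + f 2 + f 3"
  by (subst sum_4, subst four_eq_zero) (simp add: ac_simps)

lemma UNIV4: "(UNIV::4 set) = {0, 1, 2, 3}"
  by (subst UNIV_4, subst four_eq_zero) auto

lemma prod4: "prod f (UNIV::4 set) = f 0 * f 1 * f 2 * f 3"
  unfolding UNIV4 by (simp add: ac_simps)

lemma cases4: obtains "(i::4) = 0" | "i = 1" | "i = 2" | "i = 3"
  using UNIV4 by blast

lemma vec4_eq_iff: "(x :: 'a^4) = y \<longleftrightarrow> x$0 = y$0 \<and> x$1 = y$1 \<and> x$2 = y$2 \<and> x$3 = y$3"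
  by (simp add: vec_eq_iff all4)

text \<open>\<open>\<sigma>\<close> sends a row to the column of its nonzero entry, so (A x)_i =
  \<open>\<epsilon>\<close> i * x_(\<open>\<sigma>\<close> i). Products therefore compose the
  permutations in reverse order.\<close>

definition signed_perm :: "('n \<Rightarrow> 'n) \<Rightarrow> ('n \<Rightarrow> real) \<Rightarrow> real^'n^'n" where
  "signed_perm \<sigma> \<epsilon> = (\<chi> i j. if j = \<sigma> i then \<epsilon> i else 0)"

text \<open>The determinant is \<open>sign \<sigma>\<close> times
  \<open>prod \<epsilon> UNIV\<close>. Both factors are \<plusminus>1, so their equality says
  determinant one.\<close>

definition SO_signed :: "(real^'n^'n) set" where
  "SO_signed = {signed_perm \<sigma> \<epsilon> |\<sigma> \<epsilon>. bij \<sigma> \<and> (\<forall>i. \<epsilon> i = 1 \<or> \<epsilon> i = -1) \<and> prod \<epsilon> UNIV = of_int (sign \<sigma>)}"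

lemma signed_perm_mult:
  "signed_perm \<sigma> \<epsilon> ** signed_perm \<tau> \<delta> = signed_perm (\<tau> \<circ> \<sigma>) (\<lambda>i. \<epsilon> i * \<delta> (\<sigma> i))"
  for \<sigma> :: "'n::finite \<Rightarrow> 'n"
proof -
  have "(\<Sum>k\<in>UNIV. (if k = \<sigma> i then \<epsilon> i else 0) * (if j = \<tau> k then \<delta> k else 0))
      = (\<Sum>k\<in>UNIV. if k = \<sigma> i then (if j = \<tau> (\<sigma> i) then \<epsilon> i * \<delta> (\<sigma> i) else 0) else 0)" for i j
    by (rule sum.cong) auto
  then show ?thesis
    by (simp add: signed_perm_def matrix_matrix_mult_def vec_eq_iff)
qed

lemma SO_signedI:
  assumes "bij \<sigma>" "\<And>i. \<epsilon> i = 1 \<or> \<epsilon> i = -1" "prod \<epsilon> UNIV = of_int (sign \<sigma>)" "A = signed_perm \<sigma> \<epsilon>"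
  shows "A \<in> SO_signed"
  using assms unfolding SO_signed_def by blast

lemma permutes_UNIV_bij: "\<sigma> permutes UNIV \<longleftrightarrow> bij \<sigma>"
  by (auto simp: permutes_bij intro: bij_imp_permutes)

lemma permutation_bij: "permutation \<sigma> \<longleftrightarrow> bij \<sigma>" for \<sigma> :: "'n::finite \<Rightarrow> 'n"
  by (auto simp: permutation_permutes permutation_bijective permutes_UNIV_bij[symmetric])
     (auto simp: permutes_UNIV_bij dest: permutes_bij)

lemma sign_compose_UNIV:
  "bij \<sigma> \<Longrightarrow> bij \<tau> \<Longrightarrow> sign (\<sigma> \<circ> \<tau>) = sign \<sigma> * sign \<tau>" for \<sigma> :: "'n::finite \<Rightarrow> 'n"
  by (rule sign_compose) (auto simp: permutation_bij)

lemma prod_reindex_bij: "bij \<sigma> \<Longrightarrow> prod (\<lambda>i. f (\<sigma> i)) UNIV = prod f UNIV"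
  by (rule prod.reindex_bij_betw)

lemma SO_signed_mult:
  fixes A B :: "real^'n::finite^'n"
  assumes "A \<in> SO_signed" "B \<in> SO_signed"
  shows "A ** B \<in> SO_signed"
proof -
  obtain \<sigma> \<epsilon> where A: "A = signed_perm \<sigma> \<epsilon>" "bij \<sigma>" "\<forall>i. \<epsilon> i = 1 \<or> \<epsilon> i = -1" "prod \<epsilon> UNIV = of_int (sign \<sigma>)"
    using assms(1) unfolding SO_signed_def by blast
  obtain \<tau> \<delta> where B: "B = signed_perm \<tau> \<delta>" "bij \<tau>" "\<forall>i. \<delta> i = 1 \<or> \<delta> i = -1" "prod \<delta> UNIV = of_int (sign \<tau>)"
    using assms(2) unfolding SO_signed_def by blast
  show ?thesis
  proof (rule SO_signedI)
    show "A ** B = signed_perm (\<tau> \<circ> \<sigma>) (\<lambda>i. \<epsilon> i * \<delta> (\<sigma> i))"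
      unfolding A(1) B(1) by (rule signed_perm_mult)
    show "bij (\<tau> \<circ> \<sigma>)" using A(2) B(2) by (rule bij_comp)
    show "\<epsilon> i * \<delta> (\<sigma> i) = 1 \<or> \<epsilon> i * \<delta> (\<sigma> i) = -1" for i
      using A(3)[rule_format, of i] B(3)[rule_format, of "\<sigma> i"] by auto
    show "(\<Prod>i\<in>UNIV. \<epsilon> i * \<delta> (\<sigma> i)) = of_int (sign (\<tau> \<circ> \<sigma>))"
      using A B by (simp add: prod.distrib prod_reindex_bij sign_compose_UNIV)
  qed
qed

lemma signed_perm_id: "signed_perm id (\<lambda>_. 1) = mat 1"
  by (simp add: signed_perm_def mat_def vec_eq_iff)

lemma SO_signed_one: "mat 1 \<in> SO_signed"
  by (rule SO_signedI[OF _ _ _ signed_perm_id[symmetric]]) auto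

lemma SO_signed_uminus_one: "- mat 1 \<in> (SO_signed :: (real^4^4) set)"
  by (rule SO_signedI[of id "\<lambda>_. -1"])
     (auto simp: signed_perm_def mat_def vec_eq_iff sign_id)

lemma SO_signed_inverse:
  fixes A :: "real^'n::finite^'n"
  assumes "A \<in> SO_signed"
  obtains B where "B \<in> SO_signed" "A ** B = mat 1" "B ** A = mat 1"
proof -
  obtain \<sigma> \<epsilon> where A: "A = signed_perm \<sigma> \<epsilon>" "bij \<sigma>" "\<forall>i. \<epsilon> i = 1 \<or> \<epsilon> i = -1" "prod \<epsilon> UNIV = of_int (sign \<sigma>)"
    using assms(1) unfolding SO_signed_def by blast
  have perm: "permutation \<sigma>"
    using A(2) by (simp add: permutation_bij)
  \<comment> \<open>Solves y_i = \<open>\<epsilon>\<close> i * x_(\<open>\<sigma>\<close> i) for x;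
    each sign is its own inverse.\<close>
  define B where "B = signed_perm (Hilbert_Choice.inv \<sigma>) (\<lambda>i. \<epsilon> (Hilbert_Choice.inv \<sigma> i))"
  have eps: "\<epsilon> i * \<epsilon> i = 1" for i
    using A(3)[rule_format, of i] by auto
  have iA: "Hilbert_Choice.inv \<sigma> \<circ> \<sigma> = id" "\<sigma> \<circ> Hilbert_Choice.inv \<sigma> = id"
    using A(2) by (simp_all add: bij_is_inj bij_is_surj surj_iff[symmetric])
  show thesis
  proof
    show "B \<in> SO_signed"
    proof (rule SO_signedI[OF _ _ _ B_def])
      show bi: "bij (Hilbert_Choice.inv \<sigma>)" using A(2) by (rule bij_imp_bij_inv)
      show "(\<Prod>i\<in>UNIV. \<epsilon> (Hilbert_Choice.inv \<sigma> i)) = real_of_int (sign (Hilbert_Choice.inv \<sigma>))"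
        using A perm bi by (simp add: prod_reindex_bij sign_inverse)
    qed (use A in auto)
    show "A ** B = mat 1" "B ** A = mat 1"
      using A(2) eps unfolding A(1) B_def
      by (simp_all add: signed_perm_mult iA bij_is_inj bij_is_surj surj_f_inv_f signed_perm_id)
  qed
qed

lemma signed_perm_inject:
  assumes "\<And>i. \<epsilon> i \<noteq> 0" "signed_perm \<sigma> \<epsilon> = signed_perm \<tau> \<delta>"
  shows "\<sigma> = \<tau>" "\<epsilon> = \<delta>"
proof -
  have *: "(if j = \<sigma> i then \<epsilon> i else 0) = (if j = \<tau> i then \<delta> i else 0)" for i j
    using assms(2) by (simp add: signed_perm_def vec_eq_iff)
  have "\<sigma> i = \<tau> i \<and> \<epsilon> i = \<delta> i" for i
    using *[where i=i and j="\<sigma> i"] assms(1)[of i] by (auto split: if_splits)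
  then show "\<sigma> = \<tau>" "\<epsilon> = \<delta>" by auto
qed

lemma sign_cases: "sign p = 1 \<or> sign p = -1"
  by (simp add: sign_def)

text \<open>Three signs are free, and the prescribed product determines the fourth.\<close>

lemma card_sign_vectors:
  assumes "s = 1 \<or> s = -1"
  shows "card {\<epsilon> :: 4 \<Rightarrow> real. (\<forall>i. \<epsilon> i = 1 \<or> \<epsilon> i = -1) \<and> prod \<epsilon> UNIV = s} = 8"
proof -
  let ?T = "{1, -1::real} \<times> {1, -1::real} \<times> {1, -1::real}"
  let ?S = "{\<epsilon> :: 4 \<Rightarrow> real. (\<forall>i. \<epsilon> i = 1 \<or> \<epsilon> i = -1) \<and> prod \<epsilon> UNIV = s}"
  let ?f = "\<lambda>(a,b,c) i::4. if i = 0 then a * b * c * s else if i = 1 then a else if i = 2 then b else c"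
  let ?g = "\<lambda>\<epsilon>::4 \<Rightarrow> real. (\<epsilon> 1, \<epsilon> 2, \<epsilon> 3)"
  have "bij_betw ?g ?S ?T"
  proof (rule bij_betw_byWitness[where f' = ?f])
    show "\<forall>e\<in>?S. ?f (?g e) = e"
    proof
      fix e assume e: "e \<in> ?S"
      have "e 1 * e 1 = 1" "e 2 * e 2 = 1" "e 3 * e 3 = 1"
        using e by (auto simp: all4)
      then have "e 1 * e 2 * e 3 * (e 0 * e 1 * e 2 * e 3) = e 0"
        by algebra
      then show "?f (?g e) = e"
        using e by (auto simp: fun_eq_iff all4 prod4)
    qed
    show "?g ` ?S \<subseteq> ?T" by (auto simp: all4)
    show "?f ` ?T \<subseteq> ?S" using assms by (auto simp: all4 prod4)
  qed auto
  then have "card ?S = card ?T" by (rule bij_betw_same_card)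
  then show ?thesis by simp
qed

lemma card_SO_signed: "card (SO_signed :: (real^4^4) set) = 192"
proof -
  let ?E = "\<lambda>\<sigma>::4\<Rightarrow>4. {\<epsilon> :: 4 \<Rightarrow> real. (\<forall>i. \<epsilon> i = 1 \<or> \<epsilon> i = -1) \<and> prod \<epsilon> UNIV = of_int (sign \<sigma>)}"
  have e8: "card (?E \<sigma>) = 8" for \<sigma>
    by (rule card_sign_vectors) (use sign_cases[of \<sigma>] in auto)
  let ?S = "SIGMA \<sigma>:{\<sigma>. bij \<sigma>}. ?E \<sigma>"
  have "SO_signed = (\<lambda>(\<sigma>, \<epsilon>). signed_perm \<sigma> \<epsilon>) ` ?S"
    unfolding SO_signed_def by auto
  then have "card (SO_signed :: (real^4^4) set) = card ((\<lambda>(\<sigma>, \<epsilon>). signed_perm \<sigma> \<epsilon>) ` ?S)"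
    by (rule arg_cong)
  also have "\<dots> = card ?S"
  proof (rule card_image, rule inj_onI, clarify)
    fix \<sigma> \<tau> :: "4 \<Rightarrow> 4" and \<epsilon> \<delta> :: "4 \<Rightarrow> real"
    assume *: "\<forall>i. \<epsilon> i = 1 \<or> \<epsilon> i = -1" "signed_perm \<sigma> \<epsilon> = signed_perm \<tau> \<delta>"
    have "\<epsilon> i \<noteq> 0" for i using *(1)[rule_format, of i] by auto
    with *(2) show "\<sigma> = \<tau> \<and> \<epsilon> = \<delta>" using signed_perm_inject by blast
  qed
  also have "\<dots> = (\<Sum>\<sigma>\<in>{\<sigma>::4\<Rightarrow>4. bij \<sigma>}. card (?E \<sigma>))"
  proof (rule card_SigmaI)
    show "finite {\<sigma>::4\<Rightarrow>4. bij \<sigma>}" by (rule finite_subset[of _ UNIV]) auto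
    show "\<forall>\<sigma>\<in>{\<sigma>. bij \<sigma>}. finite (?E \<sigma>)"
      using e8 by (intro ballI card_ge_0_finite) simp
  qed
  also have "\<dots> = card {\<sigma>::4\<Rightarrow>4. bij \<sigma>} * 8" by (simp add: e8)
  also have "{\<sigma>::4\<Rightarrow>4. bij \<sigma>} = {\<sigma>. \<sigma> permutes UNIV}"
    by (auto simp: permutes_UNIV_bij)
  also have "card \<dots> = fact 4"
    by (rule card_permutations) auto
  finally show ?thesis by (simp add: fact_numeral)
qed

section \<open>Quaternion rotations\<close>

lemma quat_nth [simp]:
  "quat a b c d $ 0 = a" "quat a b c d $ 1 = b" "quat a b c d $ 2 = c" "quat a b c d $ 3 = d"
  by (simp_all add: quat_def axis_def)

lemma q_mult_nth [simp]:
  "q_mult p q $ 0 = p$0 * q$0 - p$1 * q$1 - p$2 * q$2 - p$3 * q$3"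
  "q_mult p q $ 1 = p$0 * q$1 + p$1 * q$0 + p$2 * q$3 - p$3 * q$2"
  "q_mult p q $ 2 = p$0 * q$2 - p$1 * q$3 + p$2 * q$0 + p$3 * q$1"
  "q_mult p q $ 3 = p$0 * q$3 + p$1 * q$2 - p$2 * q$1 + p$3 * q$0"
  by (simp_all add: q_mult_def)

definition q_conj :: "real^4 \<Rightarrow> real^4" where
  "q_conj p = quat (p$0) (-p$1) (-p$2) (-p$3)"

lemma q_conj_nth [simp]:
  "q_conj p $ 0 = p $ 0" "q_conj p $ 1 = - p $ 1" "q_conj p $ 2 = - p $ 2" "q_conj p $ 3 = - p $ 3"
  by (simp_all add: q_conj_def)

lemma norm4: "norm (p :: real^4) = sqrt ((p$0)\<^sup>2 + (p$1)\<^sup>2 + (p$2)\<^sup>2 + (p$3)\<^sup>2)"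
  by (simp add: norm_vec_def L2_set_def sum4)

lemma q_mult_assoc: "q_mult (q_mult p q) r = q_mult p (q_mult q r)"
  by (simp add: vec4_eq_iff algebra_simps)

lemma q_mult_one: "q_mult (quat 1 0 0 0) p = p" "q_mult p (quat 1 0 0 0) = p"
  by (simp_all add: vec4_eq_iff)

lemma norm_q_mult: "norm (q_mult p q) = norm p * norm q"
  unfolding norm4 real_sqrt_mult[symmetric]
  by (rule arg_cong[of _ _ sqrt]) (simp add: power2_eq_square algebra_simps)

lemma norm_q_conj [simp]: "norm (q_conj p) = norm p"
  by (simp add: norm4)

lemma norm_eq_one: "norm (p :: real^4) = 1 \<longleftrightarrow> p$0 * p$0 + p$1 * p$1 + p$2 * p$2 + p$3 * p$3 = 1"
  by (simp add: norm4 power2_eq_square)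

lemma q_conj_mult: "norm p = 1 \<Longrightarrow> q_mult (q_conj p) p = quat 1 0 0 0"
  "norm p = 1 \<Longrightarrow> q_mult p (q_conj p) = quat 1 0 0 0"
  by (simp_all add: vec4_eq_iff norm_eq_one algebra_simps)

lemma carrier_unit [simp]: "carrier unit_quaternions = {p. norm p = 1}"
  and mult_unit [simp]: "mult unit_quaternions = q_mult"
  and one_unit [simp]: "one unit_quaternions = quat 1 0 0 0"
  by (simp_all add: unit_quaternions_def)

lemma norm_one_quat: "norm (quat 1 0 0 0) = 1"
  by (simp add: norm_eq_one)

interpretation UQ: group unit_quaternions
  rewrites "carrier unit_quaternions = {p. norm p = 1}"
    and "mult unit_quaternions = q_mult"
    and "one unit_quaternions = quat 1 0 0 0"
proof -
  show "group unit_quaternions"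
    by (rule groupI)
       (auto simp: norm_q_mult q_mult_assoc q_mult_one norm_one_quat intro!: exI[of _ "q_conj _"] q_conj_mult)
qed simp_all

lemma inv_unit: "norm p = 1 \<Longrightarrow> inv\<^bsub>unit_quaternions\<^esub> p = q_conj p"
  using UQ.inv_equality[of "q_conj p" p] by (simp add: q_conj_mult)

lemma quat_rotation_vector_mult:
  "quat_rotation p q *v x = q_mult (q_mult p x) (inv\<^bsub>unit_quaternions\<^esub> q)"
proof -
  have "linear (\<lambda>x. q_mult (q_mult p x) (inv\<^bsub>unit_quaternions\<^esub> q))"
    by (rule linearI) (simp_all add: vec4_eq_iff algebra_simps)
  then show ?thesis
    unfolding quat_rotation_def by (intro matrix_works) (simp only: linear_matrix_vector_mul_eq)
qed

lemma quat_rotation_mult: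
  assumes "norm p = 1" "norm q = 1" "norm p' = 1" "norm q' = 1"
  shows "quat_rotation p q ** quat_rotation p' q' = quat_rotation (q_mult p p') (q_mult q q')"
proof -
  have "inv\<^bsub>unit_quaternions\<^esub> (q_mult q q') = q_mult (inv\<^bsub>unit_quaternions\<^esub> q') (inv\<^bsub>unit_quaternions\<^esub> q)"
    using UQ.inv_mult_group[of q q'] assms by simp
  then show ?thesis
    by (simp add: matrix_eq matrix_vector_mul_assoc[symmetric] quat_rotation_vector_mult q_mult_assoc)
qed

lemma quat_rotation_one: "quat_rotation (quat 1 0 0 0) (quat 1 0 0 0) = mat 1"
  by (simp add: matrix_eq quat_rotation_vector_mult q_mult_one)

lemma quat_rotation_nth:
  "norm q = 1 \<Longrightarrow> quat_rotation p q $ i $ j = q_mult (q_mult p (axis j 1)) (q_conj q) $ i"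
  by (simp add: quat_rotation_def matrix_def inv_unit)

text \<open>Reduces membership to sixteen entries, each a product of explicit quaternions because
  the inverse of a unit quaternion is its conjugate.\<close>

lemma quat_rotation_signed:
  assumes "norm q = 1" "bij \<sigma>" "\<forall>i. \<epsilon> i = 1 \<or> \<epsilon> i = -1" "prod \<epsilon> UNIV = of_int (sign \<sigma>)"
    "\<forall>i j. q_mult (q_mult p (axis j 1)) (q_conj q) $ i = (if j = \<sigma> i then \<epsilon> i else 0)"
  shows "quat_rotation p q = signed_perm \<sigma> \<epsilon> \<and> quat_rotation p q \<in> SO_signed"
proof
  show "quat_rotation p q = signed_perm \<sigma> \<epsilon>"
    using assms by (simp add: vec_eq_iff quat_rotation_nth signed_perm_def)
  then show "quat_rotation p q \<in> SO_signed"
    using assms by (intro SO_signedI) auto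
qed

definition tuple4 :: "'a \<Rightarrow> 'a \<Rightarrow> 'a \<Rightarrow> 'a \<Rightarrow> 4 \<Rightarrow> 'a" where
  "tuple4 a b c d i = (if i = 0 then a else if i = 1 then b else if i = 2 then c else d)"

lemma tuple4_simps [simp]:
  "tuple4 a b c d 0 = a" "tuple4 a b c d 1 = b" "tuple4 a b c d 2 = c" "tuple4 a b c d 3 = d"
  by (simp_all add: tuple4_def)

lemma sign_transposes [simp]:
  "sign (Transposition.transpose a b \<circ> Transposition.transpose c d) =
    (if a = b then 1 else -1) * (if c = d then 1 else -1)" for a b :: "'n::finite"
  by (simp add: sign_compose_UNIV sign_swap_id)

lemmas rotation_simps = all4 tuple4_simps prod4 axis_def sign_swap_id sign_transposes bij_comp
  Transposition.transpose_def norm_eq_one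

text \<open>Induction over \<open>generate\<close> has a case for inverses of generators, so this
  and the next three lemmas treat each generator together with its inverse.\<close>

lemma conj_rotation_i:
  "quat_rotation (quat 0 1 0 0) (quat 0 1 0 0) = signed_perm id (tuple4 1 1 (-1) (-1))
    \<and> quat_rotation (quat 0 1 0 0) (quat 0 1 0 0) \<in> SO_signed"
  "quat_rotation (quat 0 (-1) 0 0) (quat 0 (-1) 0 0) = signed_perm id (tuple4 1 1 (-1) (-1))
    \<and> quat_rotation (quat 0 (-1) 0 0) (quat 0 (-1) 0 0) \<in> SO_signed"
  by (rule quat_rotation_signed; simp add: rotation_simps)+

text \<open>Conjugation by (1 + i)/sqrt 2 turns the plane of j and k by a right angle. Only the
  square of the coefficient enters the matrix, hence the parameter \<open>s\<close> in place of a
  root.\<close>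

lemma conj_rotation_quarter_turn:
  assumes "s * s = 1/2"
  shows "quat_rotation (quat s s 0 0) (quat s s 0 0) = signed_perm (Transposition.transpose 2 3) (tuple4 1 1 (-1) 1)
    \<and> quat_rotation (quat s s 0 0) (quat s s 0 0) \<in> SO_signed"
  "quat_rotation (quat s (-s) 0 0) (quat s (-s) 0 0) = signed_perm (Transposition.transpose 2 3) (tuple4 1 1 1 (-1))
    \<and> quat_rotation (quat s (-s) 0 0) (quat s (-s) 0 0) \<in> SO_signed"
  by (rule quat_rotation_signed; simp add: rotation_simps assms)+

lemma conj_rotation_order_3:
  "quat_rotation (quat (1/2) (1/2) (-1/2) (1/2)) (quat (1/2) (1/2) (-1/2) (1/2)) = signed_perm (Transposition.transpose 1 2 \<circ> Transposition.transpose 2 3) (tuple4 1 (-1) (-1) 1)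
    \<and> quat_rotation (quat (1/2) (1/2) (-1/2) (1/2)) (quat (1/2) (1/2) (-1/2) (1/2)) \<in> SO_signed"
  "quat_rotation (quat (1/2) (-1/2) (1/2) (-1/2)) (quat (1/2) (-1/2) (1/2) (-1/2)) = signed_perm (Transposition.transpose 2 3 \<circ> Transposition.transpose 1 2) (tuple4 1 1 (-1) (-1))
    \<and> quat_rotation (quat (1/2) (-1/2) (1/2) (-1/2)) (quat (1/2) (-1/2) (1/2) (-1/2)) \<in> SO_signed"
  by (rule quat_rotation_signed; simp add: rotation_simps)+

lemma right_rotations:
  "quat_rotation (quat 1 0 0 0) (quat 0 1 0 0) = signed_perm (Transposition.transpose 0 1 \<circ> Transposition.transpose 2 3) (tuple4 1 (-1) (-1) 1)
    \<and> quat_rotation (quat 1 0 0 0) (quat 0 1 0 0) \<in> SO_signed"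
  "quat_rotation (quat 1 0 0 0) (quat 0 (-1) 0 0) = signed_perm (Transposition.transpose 0 1 \<circ> Transposition.transpose 2 3) (tuple4 (-1) 1 1 (-1))
    \<and> quat_rotation (quat 1 0 0 0) (quat 0 (-1) 0 0) \<in> SO_signed"
  "quat_rotation (quat 1 0 0 0) (quat 0 0 1 0) = signed_perm (Transposition.transpose 0 2 \<circ> Transposition.transpose 1 3) (tuple4 1 1 (-1) (-1))
    \<and> quat_rotation (quat 1 0 0 0) (quat 0 0 1 0) \<in> SO_signed"
  "quat_rotation (quat 1 0 0 0) (quat 0 0 (-1) 0) = signed_perm (Transposition.transpose 0 2 \<circ> Transposition.transpose 1 3) (tuple4 (-1) (-1) 1 1)
    \<and> quat_rotation (quat 1 0 0 0) (quat 0 0 (-1) 0) \<in> SO_signed"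
  by (rule quat_rotation_signed; simp add: rotation_simps)+

section \<open>The elements of \<open>(OO)'\<close>\<close>

lemma signed_perm_vec: "(signed_perm \<sigma> \<epsilon> *v x) $ i = \<epsilon> i * x $ \<sigma> i"
proof -
  have "(\<Sum>j\<in>UNIV. (if j = \<sigma> i then \<epsilon> i else 0) * x $ j) = (\<Sum>j\<in>UNIV. if j = \<sigma> i then \<epsilon> i * x $ \<sigma> i else 0)"
    by (rule sum.cong) auto
  then show ?thesis by (simp add: signed_perm_def matrix_vector_mult_def)
qed

lemma inv_sqrt_2: "1 / sqrt 2 * (1 / sqrt 2) = 1 / 2"
  by simp

section \<open>Generators and closure properties of the two binary groups\<close>

lemma generators_unit:
  "norm (quat 0 1 0 0) = 1" "norm (quat 0 0 1 0) = 1"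
  "norm (quat (1 / sqrt 2) (1 / sqrt 2) 0 0) = 1" "norm (quat (1/2) (1/2) (-1/2) (1/2)) = 1"
  by (simp_all add: norm_eq_one)

lemma inv_generators:
  "inv\<^bsub>unit_quaternions\<^esub> (quat 0 1 0 0) = quat 0 (-1) 0 0"
  "inv\<^bsub>unit_quaternions\<^esub> (quat 0 0 1 0) = quat 0 0 (-1) 0"
  "inv\<^bsub>unit_quaternions\<^esub> (quat (1 / sqrt 2) (1 / sqrt 2) 0 0) = quat (1 / sqrt 2) (- (1 / sqrt 2)) 0 0"
  "inv\<^bsub>unit_quaternions\<^esub> (quat (1/2) (1/2) (-1/2) (1/2)) = quat (1/2) (-1/2) (1/2) (-1/2)"
  by (subst inv_unit, rule generators_unit, simp add: vec4_eq_iff)+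

lemma O_tilde_unit: "p \<in> O_tilde \<Longrightarrow> norm p = 1"
  unfolding O_tilde_def
  by (frule UQ.generate_in_carrier[rotated]) (auto simp: norm_eq_one)

lemma V_tilde_unit: "p \<in> V_tilde \<Longrightarrow> norm p = 1"
  unfolding V_tilde_def
  by (frule UQ.generate_in_carrier[rotated]) (auto simp: norm_eq_one)

lemma O_tilde_mult: "p \<in> O_tilde \<Longrightarrow> q \<in> O_tilde \<Longrightarrow> q_mult p q \<in> O_tilde"
  unfolding O_tilde_def using generate.eng[of p unit_quaternions _ q] by simp

lemma V_tilde_mult: "p \<in> V_tilde \<Longrightarrow> q \<in> V_tilde \<Longrightarrow> q_mult p q \<in> V_tilde"
  unfolding V_tilde_def using generate.eng[of p unit_quaternions _ q] by simp

lemma O_tilde_one: "quat 1 0 0 0 \<in> O_tilde"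
  unfolding O_tilde_def using generate.one[of unit_quaternions] by simp

lemma V_tilde_one: "quat 1 0 0 0 \<in> V_tilde"
  unfolding V_tilde_def using generate.one[of unit_quaternions] by simp

lemma O_tilde_inv: "p \<in> O_tilde \<Longrightarrow> inv\<^bsub>unit_quaternions\<^esub> p \<in> O_tilde"
  unfolding O_tilde_def
  by (rule UQ.generate_m_inv_closed) (auto simp: norm_eq_one)

lemma V_tilde_inv: "p \<in> V_tilde \<Longrightarrow> inv\<^bsub>unit_quaternions\<^esub> p \<in> V_tilde"
  unfolding V_tilde_def
  by (rule UQ.generate_m_inv_closed) (auto simp: norm_eq_one)

text \<open>Conjugation by p is multiplicative in p, so the generators decide. Geometrically, these
  are the rotations of the octahedron with vertices \<plusminus>i, \<plusminus>j,
  \<plusminus>k.\<close>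

lemma O_tilde_rotation_signed: "p \<in> O_tilde \<Longrightarrow> quat_rotation p p \<in> SO_signed"
  unfolding O_tilde_def
proof (induction rule: generate.induct)
  case one
  show ?case by (simp add: quat_rotation_one SO_signed_one)
next
  case (incl h)
  then show ?case using conj_rotation_i conj_rotation_order_3 conj_rotation_quarter_turn[OF inv_sqrt_2] by auto
next
  case (inv h)
  then show ?case using conj_rotation_i conj_rotation_order_3 conj_rotation_quarter_turn[OF inv_sqrt_2] inv_generators by auto
next
  case (eng h1 h2)
  then have "norm h1 = 1" "norm h2 = 1"
    using O_tilde_unit unfolding O_tilde_def by auto
  then show ?case
    using SO_signed_mult[OF eng.IH] by (simp add: quat_rotation_mult)
qed

lemma V_tilde_rotation_signed: "v \<in> V_tilde \<Longrightarrow> quat_rotation (quat 1 0 0 0) v \<in> SO_signed"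
  unfolding V_tilde_def
proof (induction rule: generate.induct)
  case one
  show ?case by (simp add: quat_rotation_one SO_signed_one)
next
  case (incl h)
  then show ?case using right_rotations by auto
next
  case (inv h)
  then show ?case using right_rotations inv_generators by auto
next
  case (eng h1 h2)
  then have "norm h1 = 1" "norm h2 = 1"
    using V_tilde_unit unfolding V_tilde_def by auto
  then show ?case
    using SO_signed_mult[OF eng.IH] by (simp add: quat_rotation_mult norm_one_quat q_mult_one)
qed

lemma SO_signed_axis:
  assumes "A \<in> SO_signed" "s = 1 \<or> s = -1"
  shows "\<exists>j t. (t = 1 \<or> t = -1) \<and> A *v axis i s = axis j t"
proof -
  obtain \<sigma> \<epsilon> where A: "A = signed_perm \<sigma> \<epsilon>" "bij \<sigma>" "\<forall>i. \<epsilon> i = 1 \<or> \<epsilon> i = -1"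
    using assms(1) unfolding SO_signed_def by blast
  obtain j where j: "i = \<sigma> j" using A(2) by (metis bij_pointE)
  have "A *v axis i s = axis j (\<epsilon> j * s)"
    using A(2) unfolding A(1) j
    by (auto simp: vec_eq_iff signed_perm_vec axis_def bij_is_inj inj_eq)
  moreover have "\<epsilon> j * s = 1 \<or> \<epsilon> j * s = -1"
    using A(3)[rule_format, of j] assms(2) by auto
  ultimately show ?thesis by blast
qed

text \<open>This is the quaternion group. Each v is the image of 1 under right multiplication by v,
  a signed permutation matrix; conversely, products and inverses of i and j reach all eight signed
  axis vectors.\<close>

lemma V_tilde_eq: "V_tilde = {axis i s |i s. s = 1 \<or> s = -1}"
proof (intro equalityI subsetI)
  fix v assume v: "v \<in> V_tilde"
  let ?w = "inv\<^bsub>unit_quaternions\<^esub> v"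
  have "v = quat_rotation (quat 1 0 0 0) ?w *v axis 0 1"
    using V_tilde_unit[OF v]
    by (simp add: quat_rotation_vector_mult q_mult_one) (simp add: vec4_eq_iff axis_def)
  moreover have "quat_rotation (quat 1 0 0 0) ?w \<in> SO_signed"
    using v by (intro V_tilde_rotation_signed V_tilde_inv)
  ultimately show "v \<in> {axis i s |i s. s = 1 \<or> s = -1}"
    using SO_signed_axis[of _ 1 0] by force
next
  fix v :: "real^4" assume "v \<in> {axis i s |i s. s = 1 \<or> s = -1}"
  then obtain i s where v: "v = axis i s" and s: "s = 1 \<or> s = -1" by blast
  have I: "quat 0 1 0 0 \<in> V_tilde" and J: "quat 0 0 1 0 \<in> V_tilde"
    unfolding V_tilde_def by (auto intro: generate.incl)
  note IJ = V_tilde_mult[OF I J] V_tilde_mult[OF I I] V_tilde_inv[OF I] V_tilde_inv[OF J]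
  note JI = V_tilde_mult[OF J I]
  have e: "axis 0 1 = quat 1 0 0 0" "axis 1 1 = quat 0 1 0 0" "axis 2 1 = quat 0 0 1 0"
    "axis 3 1 = q_mult (quat 0 1 0 0) (quat 0 0 1 0)" "axis 0 (-1) = q_mult (quat 0 1 0 0) (quat 0 1 0 0)"
    "axis 1 (-1) = quat 0 (-1) 0 0" "axis 2 (-1) = quat 0 0 (-1) 0"
    "axis 3 (-1) = q_mult (quat 0 0 1 0) (quat 0 1 0 0)"
    by (simp_all add: vec4_eq_iff axis_def)
  show "v \<in> V_tilde"
    unfolding v using s
    by (cases i rule: cases4; elim disjE)
       (simp_all only: e I J JI IJ IJ[unfolded inv_generators] V_tilde_one)
qed

text \<open>Normality of \<open>V_tilde\<close> in \<open>O_tilde\<close>: conjugation is a signed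
  permutation matrix, and \<open>V_tilde\<close> is the set of all signed axis vectors.\<close>

lemma V_tilde_conj:
  assumes "p \<in> O_tilde" "v \<in> V_tilde"
  shows "q_mult (q_mult (inv\<^bsub>unit_quaternions\<^esub> p) v) p \<in> V_tilde"
proof -
  let ?p = "inv\<^bsub>unit_quaternions\<^esub> p"
  have "quat_rotation ?p ?p *v v = q_mult (q_mult ?p v) p"
    using O_tilde_unit[OF assms(1)] by (simp add: quat_rotation_vector_mult)
  moreover have "quat_rotation ?p ?p \<in> SO_signed"
    using assms by (intro O_tilde_rotation_signed O_tilde_inv)
  moreover obtain i s where "v = axis i s" "s = 1 \<or> s = -1"
    using assms(2) unfolding V_tilde_eq by blast
  ultimately obtain j t where "t = 1 \<or> t = -1" "q_mult (q_mult ?p v) p = axis j t"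
    using SO_signed_axis[of "quat_rotation ?p ?p" s i] by auto
  then show ?thesis unfolding V_tilde_eq by blast
qed

lemma V_tilde_subset_O_tilde: "V_tilde \<subseteq> O_tilde"
proof
  let ?c = "quat (1/2) (1/2) (-1/2) (1/2)"
  have I: "quat 0 1 0 0 \<in> O_tilde" and c: "?c \<in> O_tilde"
    unfolding O_tilde_def by (auto intro: generate.incl)
  \<comment> \<open>The quaternion j is not among the generators of \<open>O_tilde\<close>;
    conjugating i by c gives k, and k i = j.\<close>
  have "quat 0 0 1 0 = q_mult (q_mult (q_mult ?c (quat 0 1 0 0)) (inv\<^bsub>unit_quaternions\<^esub> ?c)) (quat 0 1 0 0)"
    unfolding inv_generators by (simp add: vec4_eq_iff)
  then have J: "quat 0 0 1 0 \<in> O_tilde"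
    using I c by (metis O_tilde_mult O_tilde_inv)
  fix v assume "v \<in> V_tilde"
  then show "v \<in> O_tilde"
    unfolding V_tilde_def
  proof (induction rule: generate.induct)
    case one show ?case using O_tilde_one by simp
  next
    case (incl h) then show ?case using I J by auto
  next
    case (inv h) then show ?case using O_tilde_inv[OF I] O_tilde_inv[OF J] by auto
  next
    case (eng h1 h2) then show ?case using O_tilde_mult by simp
  qed
qed

lemma l_coset_V_tilde_eq_iff:
  assumes "norm p = 1" "norm q = 1"
  shows "p <#\<^bsub>unit_quaternions\<^esub> V_tilde = q <#\<^bsub>unit_quaternions\<^esub> V_tilde \<longleftrightarrow> (\<exists>v\<in>V_tilde. q = q_mult p v)"
proof
  assume "p <#\<^bsub>unit_quaternions\<^esub> V_tilde = q <#\<^bsub>unit_quaternions\<^esub> V_tilde"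
  moreover have "q \<in> q <#\<^bsub>unit_quaternions\<^esub> V_tilde"
    unfolding l_coset_def using V_tilde_one by (auto intro!: bexI[of _ "quat 1 0 0 0"] simp: q_mult_one)
  ultimately show "\<exists>v\<in>V_tilde. q = q_mult p v"
    unfolding l_coset_def by auto
next
  assume "\<exists>v\<in>V_tilde. q = q_mult p v"
  then obtain v where v: "v \<in> V_tilde" "q = q_mult p v" by blast
  have "q_mult p w = q_mult q (q_mult (inv\<^bsub>unit_quaternions\<^esub> v) w)" for w
    using V_tilde_unit[OF v(1)] unfolding v(2)
    by (simp add: q_mult_assoc[symmetric]) (simp add: q_mult_assoc q_mult_one)
  moreover have "q_mult q w = q_mult p (q_mult v w)" for w
    unfolding v(2) by (rule q_mult_assoc)
  ultimately show "p <#\<^bsub>unit_quaternions\<^esub> V_tilde = q <#\<^bsub>unit_quaternions\<^esub> V_tilde"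
    using V_tilde_mult V_tilde_inv v(1) unfolding l_coset_def
    by (auto, metis, metis)
qed

text \<open>Equality of the cosets of p and q means q = p v with v in \<open>V_tilde\<close>;
  parametrising by p and v removes the side condition.\<close>

lemma carrier_OO': "carrier OO' = {quat_rotation p (q_mult p v) |p v. p \<in> O_tilde \<and> v \<in> V_tilde}"
proof -
  have "q_mult p v \<in> O_tilde" if "p \<in> O_tilde" "v \<in> V_tilde" for p v
    using that V_tilde_subset_O_tilde O_tilde_mult by blast
  then show ?thesis
    unfolding OO'_def partial_object.simps using l_coset_V_tilde_eq_iff O_tilde_unit by blast
qed

lemma OO'_closed:
  assumes "A \<in> carrier OO'" "B \<in> carrier OO'"
  shows "A ** B \<in> carrier OO'"
proof -
  obtain p v where A: "A = quat_rotation p (q_mult p v)" "p \<in> O_tilde" "v \<in> V_tilde"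
    using assms(1) unfolding carrier_OO' by blast
  obtain p' v' where B: "B = quat_rotation p' (q_mult p' v')" "p' \<in> O_tilde" "v' \<in> V_tilde"
    using assms(2) unfolding carrier_OO' by blast
  note u = O_tilde_unit[OF A(2)] O_tilde_unit[OF B(2)] V_tilde_unit[OF A(3)] V_tilde_unit[OF B(3)]
  \<comment> \<open>Moves p' to the left past v: p v p' v' = p p' (p'^-1 v p') v'.\<close>
  define w where "w = q_mult (q_mult (inv\<^bsub>unit_quaternions\<^esub> p') v) p'"
  have w: "w \<in> V_tilde"
    unfolding w_def using A B by (intro V_tilde_conj)
  have "q_mult p' (q_mult (q_mult (inv\<^bsub>unit_quaternions\<^esub> p') v) p') = q_mult v p'"
    using u by (simp add: q_mult_assoc[symmetric] q_mult_one)
  then have "q_mult (q_mult p v) (q_mult p' v') = q_mult (q_mult p p') (q_mult w v')"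
    unfolding w_def by (metis q_mult_assoc)
  then have "A ** B = quat_rotation (q_mult p p') (q_mult (q_mult p p') (q_mult w v'))"
    using u unfolding A(1) B(1) by (simp add: quat_rotation_mult norm_q_mult)
  then show ?thesis
    unfolding carrier_OO' using O_tilde_mult V_tilde_mult A B w by blast
qed

lemma OO'_subset_SO_signed: "carrier OO' \<subseteq> SO_signed"
proof
  fix A assume "A \<in> carrier OO'"
  then obtain p v where A: "A = quat_rotation p (q_mult p v)" "p \<in> O_tilde" "v \<in> V_tilde"
    unfolding carrier_OO' by blast
  \<comment> \<open>Splits the rotation into right multiplication by the inverse of v, followed by
    conjugation by p.\<close>
  have "A = quat_rotation p p ** quat_rotation (quat 1 0 0 0) v"
    using O_tilde_unit[OF A(2)] V_tilde_unit[OF A(3)] unfolding A(1)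
    by (simp add: quat_rotation_mult norm_one_quat q_mult_one)
  then show "A \<in> SO_signed"
    using SO_signed_mult O_tilde_rotation_signed V_tilde_rotation_signed A by auto
qed

section \<open>Every signed permutation matrix of determinant one occurs\<close>

lemma signs_mult: "a = 1 \<or> a = -1 \<Longrightarrow> b = 1 \<or> b = -1 \<Longrightarrow> a * b = 1 \<or> a * b = -1" for a b :: real
  by auto

text \<open>The even sign changes form an elementary abelian group of order 8, generated by -1 and
  the conjugations by i and j. The matrix -1 is the square of right multiplication by the inverse of
  i.\<close>

lemma OO'_diagonal:
  assumes "\<forall>i. \<epsilon> i = 1 \<or> \<epsilon> i = -1" "prod \<epsilon> UNIV = 1"
  shows "signed_perm id \<epsilon> \<in> carrier OO'"
proof -
  have rot: "quat_rotation p p \<in> carrier OO'" if "p \<in> O_tilde" for p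
    using that V_tilde_one unfolding carrier_OO' by (metis (mono_tags, lifting) mem_Collect_eq q_mult_one(2))
  have I: "quat 0 1 0 0 \<in> V_tilde" and J: "quat 0 0 1 0 \<in> V_tilde"
    unfolding V_tilde_def by (auto intro: generate.incl)
  have mult: "signed_perm id (tuple4 (a*a') (b*b') (c*c') (d*d')) \<in> carrier OO'"
    if "signed_perm id (tuple4 a b c d) \<in> carrier OO'" "signed_perm id (tuple4 a' b' c' d') \<in> carrier OO'"
    for a b c d a' b' c' d'
  proof -
    have "(\<lambda>i. tuple4 a b c d i * tuple4 a' b' c' d' i) = tuple4 (a*a') (b*b') (c*c') (d*d')"
      by (simp add: fun_eq_iff all4)
    with OO'_closed[OF that] show ?thesis by (simp add: signed_perm_mult)
  qed
  have m: "signed_perm id (tuple4 (-1) (-1) (-1) (-1)) \<in> carrier OO'"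
  proof -
    have "quat_rotation (quat 1 0 0 0) (quat 0 1 0 0) \<in> carrier OO'"
      using O_tilde_one I unfolding carrier_OO' by (metis (mono_tags, lifting) mem_Collect_eq q_mult_one(1))
    note OO'_closed[OF this this]
    moreover have "quat_rotation (quat 1 0 0 0) (quat 0 1 0 0) ** quat_rotation (quat 1 0 0 0) (quat 0 1 0 0)
        = signed_perm id (tuple4 (-1) (-1) (-1) (-1))"
      unfolding conjunct1[OF right_rotations(1)] signed_perm_mult
      by (rule arg_cong2[of _ _ _ _ signed_perm]) (simp_all add: fun_eq_iff rotation_simps)
    ultimately show ?thesis by simp
  qed
  have di: "signed_perm id (tuple4 1 1 (-1) (-1)) \<in> carrier OO'"
    using rot[of "quat 0 1 0 0"] I V_tilde_subset_O_tilde conj_rotation_i by auto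
  have dj: "signed_perm id (tuple4 1 (-1) 1 (-1)) \<in> carrier OO'"
  proof -
    have "quat_rotation (quat 0 0 1 0) (quat 0 0 1 0) = signed_perm id (tuple4 1 (-1) 1 (-1))"
      by (rule conjunct1[OF quat_rotation_signed]; simp add: rotation_simps)
    then show ?thesis
      using rot[of "quat 0 0 1 0"] J V_tilde_subset_O_tilde by auto
  qed
  have "\<epsilon> = tuple4 (\<epsilon> 0) (\<epsilon> 1) (\<epsilon> 2) (\<epsilon> 0 * \<epsilon> 1 * \<epsilon> 2)"
  proof -
    have "\<epsilon> 3 = \<epsilon> 0 * \<epsilon> 1 * \<epsilon> 2"
      using assms(1)[rule_format, of 0] assms(1)[rule_format, of 1] assms(1)[rule_format, of 2] assms(2)
      by (auto simp: prod4)
    then show ?thesis by (simp add: fun_eq_iff all4)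
  qed
  \<comment> \<open>The facts used contain all eight products of the three generators.\<close>
  moreover have "signed_perm id (tuple4 (\<epsilon> 0) (\<epsilon> 1) (\<epsilon> 2) (\<epsilon> 0 * \<epsilon> 1 * \<epsilon> 2)) \<in> carrier OO'"
    using assms(1)[rule_format, of 0] assms(1)[rule_format, of 1] assms(1)[rule_format, of 2]
      m di dj mult[OF m m] mult[OF di dj] mult[OF m di] mult[OF m dj] mult[OF m mult[OF di dj]]
    by auto
  ultimately show ?thesis by simp
qed

text \<open>The image of \<open>OO'\<close> under forgetting signs. \<open>OO'_diagonal\<close>
  supplies the kernel, so all that remains is to find every transposition in this image. With the
  determinant condition recorded, two lifts of one permutation differ by an even sign
  change.\<close>

definition OO'_perms :: "(4 \<Rightarrow> 4) set" where
  "OO'_perms = {\<sigma>. bij \<sigma> \<and> (\<exists>\<epsilon>. (\<forall>i. \<epsilon> i = 1 \<or> \<epsilon> i = -1) \<and> prod \<epsilon> UNIV = of_int (sign \<sigma>) \<and>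
     signed_perm \<sigma> \<epsilon> \<in> carrier OO')}"

lemma OO'_permsI:
  assumes "bij \<sigma>" "\<forall>i. \<epsilon> i = 1 \<or> \<epsilon> i = -1" "prod \<epsilon> UNIV = of_int (sign \<sigma>)"
    "signed_perm \<sigma> \<epsilon> \<in> carrier OO'"
  shows "\<sigma> \<in> OO'_perms"
  using assms unfolding OO'_perms_def by blast

lemma OO'_perms_comp:
  assumes "\<sigma> \<in> OO'_perms" "\<tau> \<in> OO'_perms"
  shows "\<tau> \<circ> \<sigma> \<in> OO'_perms"
proof -
  obtain \<epsilon> where s: "bij \<sigma>" "\<forall>i. \<epsilon> i = 1 \<or> \<epsilon> i = -1" "prod \<epsilon> UNIV = of_int (sign \<sigma>)" "signed_perm \<sigma> \<epsilon> \<in> carrier OO'"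
    using assms(1) unfolding OO'_perms_def by blast
  obtain \<delta> where t: "bij \<tau>" "\<forall>i. \<delta> i = 1 \<or> \<delta> i = -1" "prod \<delta> UNIV = of_int (sign \<tau>)" "signed_perm \<tau> \<delta> \<in> carrier OO'"
    using assms(2) unfolding OO'_perms_def by blast
  show ?thesis
  proof (rule OO'_permsI)
    show "bij (\<tau> \<circ> \<sigma>)" using s(1) t(1) by (rule bij_comp)
    show "signed_perm (\<tau> \<circ> \<sigma>) (\<lambda>i. \<epsilon> i * \<delta> (\<sigma> i)) \<in> carrier OO'"
      using OO'_closed[OF s(4) t(4)] by (simp add: signed_perm_mult)
    show "(\<Prod>i\<in>UNIV. \<epsilon> i * \<delta> (\<sigma> i)) = of_int (sign (\<tau> \<circ> \<sigma>))"
      using s t by (simp add: prod.distrib prod_reindex_bij sign_compose_UNIV)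
    show "\<forall>i. \<epsilon> i * \<delta> (\<sigma> i) = 1 \<or> \<epsilon> i * \<delta> (\<sigma> i) = -1"
      using s(2) t(2) by (intro allI signs_mult) simp_all
  qed
qed

lemma OO'_perms_transpose: "Transposition.transpose a b \<in> OO'_perms"
proof -
  let ?t = "Transposition.transpose :: 4 \<Rightarrow> _"
  let ?c = "?t 1 2 \<circ> ?t 2 3"
  have rot: "quat_rotation p (q_mult p v) \<in> carrier OO'" if "p \<in> O_tilde" "v \<in> V_tilde" for p v
    using that unfolding carrier_OO' by blast
  have g: "?t 2 3 \<in> OO'_perms"
  proof -
    have "quat (1 / sqrt 2) (1 / sqrt 2) 0 0 \<in> O_tilde"
      unfolding O_tilde_def by (auto intro: generate.incl)
    from rot[OF this V_tilde_one] have "signed_perm (?t 2 3) (tuple4 1 1 (-1) 1) \<in> carrier OO'"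
      using conj_rotation_quarter_turn[OF inv_sqrt_2] by (simp add: q_mult_one)
    then show ?thesis
      unfolding OO'_perms_def by (auto intro!: exI[of _ "tuple4 1 1 (-1) 1"] simp: rotation_simps)
  qed
  have c: "?c \<in> OO'_perms"
  proof -
    have "quat (1/2) (1/2) (-1/2) (1/2) \<in> O_tilde"
      unfolding O_tilde_def by (auto intro: generate.incl)
    from rot[OF this V_tilde_one] have "signed_perm ?c (tuple4 1 (-1) (-1) 1) \<in> carrier OO'"
      using conjunct1[OF conj_rotation_order_3(1)] by (simp add: q_mult_one)
    then show ?thesis
      unfolding OO'_perms_def by (auto intro!: exI[of _ "tuple4 1 (-1) (-1) 1"] simp: rotation_simps)
  qed
  have r: "?t 0 1 \<circ> ?t 2 3 \<in> OO'_perms"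
  proof -
    have "quat 0 1 0 0 \<in> V_tilde"
      unfolding V_tilde_def by (auto intro: generate.incl)
    from rot[OF O_tilde_one this] have "signed_perm (?t 0 1 \<circ> ?t 2 3) (tuple4 1 (-1) (-1) 1) \<in> carrier OO'"
      using conjunct1[OF right_rotations(1)] by (simp add: q_mult_one)
    then show ?thesis
      unfolding OO'_perms_def by (auto intro!: exI[of _ "tuple4 1 (-1) (-1) 1"] simp: rotation_simps)
  qed
  \<comment> \<open>The 3-cycle maps 1 to 2, 2 to 3 and 3 to 1, and its square is its inverse, so
    this is conjugation. It carries (0 1) to (0 2) to (0 3), and (2 3) to (1 3) to (1 2).\<close>
  have conj: "?c \<circ> (x \<circ> (?c \<circ> ?c)) \<in> OO'_perms" if "x \<in> OO'_perms" for x
    by (rule OO'_perms_comp[OF OO'_perms_comp[OF OO'_perms_comp[OF c c] that] c])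
  have t01: "?t 0 1 \<in> OO'_perms"
    using OO'_perms_comp[OF g r] by (simp add: comp_assoc)
  have t02: "?t 0 2 \<in> OO'_perms"
    by (rule back_subst[of "\<lambda>x. x \<in> OO'_perms", OF conj[OF t01]]) (rule ext, rename_tac i, case_tac i rule: cases4; simp add: Transposition.transpose_def)
  have t03: "?t 0 3 \<in> OO'_perms"
    by (rule back_subst[of "\<lambda>x. x \<in> OO'_perms", OF conj[OF t02]]) (rule ext, rename_tac i, case_tac i rule: cases4; simp add: Transposition.transpose_def)
  have t13: "?t 1 3 \<in> OO'_perms"
    by (rule back_subst[of "\<lambda>x. x \<in> OO'_perms", OF conj[OF g]]) (rule ext, rename_tac i, case_tac i rule: cases4; simp add: Transposition.transpose_def)
  have t12: "?t 1 2 \<in> OO'_perms"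
    by (rule back_subst[of "\<lambda>x. x \<in> OO'_perms", OF conj[OF t13]]) (rule ext, rename_tac i, case_tac i rule: cases4; simp add: Transposition.transpose_def)
  have id: "id \<in> OO'_perms"
    using OO'_perms_comp[OF g g] by simp
  show ?thesis
    using id t01 t02 t03 t12 t13 g
    by (cases a rule: cases4; cases b rule: cases4) (simp_all add: transpose_commute)
qed

text \<open>Induction over products of transpositions, for all sign vectors at once: a lift of the
  last transposition is split off, and its signs \<open>\<delta>\<close> are absorbed into those of
  the remaining permutation, where \<open>\<delta>\<close> squares to 1.\<close>

lemma signed_perm_in_OO':
  assumes "bij \<sigma>" "\<forall>i. \<epsilon> i = 1 \<or> \<epsilon> i = -1" "prod \<epsilon> UNIV = of_int (sign \<sigma>)"
  shows "signed_perm \<sigma> \<epsilon> \<in> carrier OO'"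
proof -
  have "\<sigma> permutes UNIV" using assms(1) by (simp add: permutes_UNIV_bij)
  moreover have "finite (UNIV :: 4 set)" by simp
  ultimately have "\<forall>\<epsilon>. (\<forall>i. \<epsilon> i = 1 \<or> \<epsilon> i = -1) \<longrightarrow> prod \<epsilon> UNIV = of_int (sign \<sigma>)
      \<longrightarrow> signed_perm \<sigma> \<epsilon> \<in> carrier OO'"
  proof (induction rule: permutes_induct)
    case id
    then show ?case using OO'_diagonal by (auto simp: id_def)
  next
    case (swap a b \<sigma>)
    let ?t = "Transposition.transpose a b"
    have bij: "bij \<sigma>" using swap.hyps by (simp add: permutes_UNIV_bij)
    obtain \<delta> where d: "\<forall>i. \<delta> i = 1 \<or> \<delta> i = -1" "prod \<delta> UNIV = of_int (sign ?t)" "signed_perm ?t \<delta> \<in> carrier OO'"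
      using OO'_perms_transpose[of a b] unfolding OO'_perms_def by blast
    have dd: "\<delta> i * \<delta> i = 1" for i using d(1)[rule_format, of i] by auto
    show ?case
    proof (intro allI impI)
      fix \<epsilon> :: "4 \<Rightarrow> real" assume e: "\<forall>i. \<epsilon> i = 1 \<or> \<epsilon> i = -1" "prod \<epsilon> UNIV = of_int (sign (?t \<circ> \<sigma>))"
      let ?e = "\<lambda>i. \<epsilon> i * \<delta> (\<sigma> i)"
      have "prod ?e UNIV = of_int (sign \<sigma>)"
        using e d bij sign_cases[of ?t] by (auto simp: prod.distrib prod_reindex_bij sign_compose_UNIV)
      moreover have "\<forall>i. ?e i = 1 \<or> ?e i = -1"
        using e(1) d(1) by (intro allI signs_mult) simp_all
      ultimately have "signed_perm \<sigma> ?e \<in> carrier OO'"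
        by (intro swap.IH[rule_format]) simp_all
      from OO'_closed[OF this d(3)] show "signed_perm (?t \<circ> \<sigma>) \<epsilon> \<in> carrier OO'"
        by (simp add: signed_perm_mult mult.assoc dd)
    qed
  qed
  then show ?thesis using assms by blast
qed

theorem carrier_OO'_eq: "carrier OO' = SO_signed"
  using OO'_subset_SO_signed signed_perm_in_OO' unfolding SO_signed_def by blast

section \<open>The action on projective space\<close>

lemma mult_OO' [simp]: "mult OO' = (**)" and one_OO' [simp]: "one OO' = mat 1"
  by (simp_all add: OO'_def)

lemma group_OO': "group OO'"
proof (rule groupI)
  show "\<exists>y\<in>carrier OO'. y \<otimes>\<^bsub>OO'\<^esub> x = \<one>\<^bsub>OO'\<^esub>" if "x \<in> carrier OO'" for x
    using SO_signed_inverse[of x] that unfolding carrier_OO'_eq by auto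
qed (auto simp: carrier_OO'_eq SO_signed_mult SO_signed_one matrix_mul_assoc)

interpretation OO: group OO' by (rule group_OO')

abbreviation plus_minus_one :: "(real^4^4) set" where
  "plus_minus_one \<equiv> {mat 1, - mat 1}"

lemma matrix_mul_uminus: "(- A) ** B = - (A ** B)" "A ** (- B) = - (A ** B)"
  for A :: "real^'n^'m" and B :: "real^'k^'n"
  by (simp_all add: vec_eq_iff matrix_matrix_mult_def sum_negf)

lemma mat_1_neq_uminus: "mat 1 \<noteq> (- mat 1 :: real^4^4)"
  by (simp add: vec4_eq_iff mat_def)

lemma normal_plus_minus_one: "plus_minus_one \<lhd> OO'"
proof -
  have "subgroup plus_minus_one OO'"
    by (rule OO.subgroupI)
       (auto simp: carrier_OO'_eq SO_signed_one SO_signed_uminus_one matrix_mul_uminus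
          OO.inv_equality[of "mat 1" "mat 1"] OO.inv_equality[of "- mat 1" "- mat 1"])
  then show ?thesis
    by (rule OO.normalI) (auto simp: r_coset_def l_coset_def matrix_mul_uminus)
qed

lemma r_coset_plus_minus_one: "plus_minus_one #>\<^bsub>OO'\<^esub> A = {A, - A}"
  by (auto simp: r_coset_def matrix_mul_uminus)

lemma order_OO'_mod: "order OO'_mod = 96"
proof -
  have "card (rcosets\<^bsub>OO'\<^esub> plus_minus_one) * card plus_minus_one = order OO'"
    using OO.lagrange normal_imp_subgroup[OF normal_plus_minus_one] by simp
  moreover have "card plus_minus_one = 2"
    using mat_1_neq_uminus by simp
  ultimately show ?thesis
    by (simp add: order_def FactGroup_def carrier_OO'_eq card_SO_signed)
qed

section \<open>Real matrices acting on complex lines\<close>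

lemma complexify_mult: "complexify (A ** B) = complexify A ** complexify B"
  by (simp add: complexify_def matrix_matrix_mult_def vec_eq_iff)

lemma complexify_one: "complexify (mat 1) = mat 1"
  by (simp add: complexify_def mat_def vec_eq_iff)

lemma complexify_uminus_vec: "complexify (- A) *v x = - (complexify A *v x)"
  by (simp add: complexify_def matrix_vector_mult_def vec_eq_iff sum_negf)

lemma span_singleton_in_P3: "x \<noteq> 0 \<Longrightarrow> vec.span {x} \<in> P3"
  unfolding P3_def
  by (simp add: vec.subspace_span vec.dim_eq_card_independent)

lemma P3_cases:
  assumes "L \<in> P3"
  obtains x where "x \<noteq> 0" "L = vec.span {x}"
proof -
  from assms have L: "vec.subspace L" "vec.dim L = 1" by (auto simp: P3_def)
  obtain B where B: "B \<subseteq> L" "vec.independent B" "L \<subseteq> vec.span B" "card B = vec.dim L"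
    using vec.basis_exists[of L] by blast
  then obtain x where x: "B = {x}" using L by (metis card_1_singletonE)
  have "x \<noteq> 0" using B(2) x vec.dependent_zero by auto
  moreover have "L = vec.span {x}"
    using B L(1) x vec.span_subspace by blast
  ultimately show thesis by (rule that)
qed

lemma span_singleton_eq_iff:
  fixes x y :: "'a::field^'n"
  assumes "x \<noteq> 0"
  shows "vec.span {x} = vec.span {y} \<longleftrightarrow> (\<exists>c. c \<noteq> 0 \<and> x = c *s y)"
proof
  assume "vec.span {x} = vec.span {y}"
  then have "x \<in> vec.span {y}" by (metis vec.span_base singletonI)
  then obtain c where "x = c *s y" unfolding vec.span_singleton by blast
  with assms show "\<exists>c. c \<noteq> 0 \<and> x = c *s y" by (intro exI[of _ c]) auto
next
  assume "\<exists>c. c \<noteq> 0 \<and> x = c *s y"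
  then obtain c where c: "c \<noteq> 0" "x = c *s y" by blast
  have "k *s y = (k / c) *s x" and "k *s x = (k * c) *s y" for k
    using c by (simp_all add: vector_smult_assoc)
  then show "vec.span {x} = vec.span {y}"
    unfolding vec.span_singleton by (intro equalityI image_subsetI) (metis rangeI)+
qed

lemma image_span_singleton: "(*v) M ` vec.span {x} = vec.span {M *v x}" for M :: "'a::field^'n^'m"
  by (simp add: vec.span_singleton image_image vector_scalar_commute)

lemma complexify_vec_nonzero:
  assumes "A \<in> carrier OO'" "x \<noteq> 0"
  shows "complexify A *v x \<noteq> 0"
proof
  assume "complexify A *v x = 0"
  moreover obtain B where "B ** A = mat 1"
    using SO_signed_inverse[of A] assms unfolding carrier_OO'_eq by auto
  ultimately have "x = complexify B *v 0"
    by (metis complexify_mult complexify_one matrix_vector_mul_assoc matrix_vector_mul_lid)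
  with assms show False by simp
qed

lemma proj_action_span:
  "x \<noteq> 0 \<Longrightarrow> proj_action A (vec.span {x}) = vec.span {complexify A *v x}"
  by (simp add: proj_action_def span_singleton_in_P3 image_span_singleton)

lemma proj_action_closed: "A \<in> carrier OO' \<Longrightarrow> L \<in> P3 \<Longrightarrow> proj_action A L \<in> P3"
  by (erule P3_cases) (simp add: proj_action_span span_singleton_in_P3 complexify_vec_nonzero)

lemma proj_action_mult:
  "B \<in> carrier OO' \<Longrightarrow> L \<in> P3 \<Longrightarrow> proj_action (A ** B) L = proj_action A (proj_action B L)"
  by (erule P3_cases)
     (simp add: proj_action_span complexify_vec_nonzero complexify_mult matrix_vector_mul_assoc)

lemma proj_action_one: "L \<in> P3 \<Longrightarrow> proj_action (mat 1) L = L"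
  by (erule P3_cases) (simp add: proj_action_span complexify_one)

lemma proj_action_uminus: "proj_action (- A) = proj_action A"
proof
  fix L show "proj_action (- A) L = proj_action A L"
  proof (cases "L \<in> P3")
    case True
    then obtain x where x: "x \<noteq> 0" "L = vec.span {x}" by (rule P3_cases)
    have "vec.span {- y} = vec.span {y}" for y :: "complex^4"
      unfolding vec.span_singleton by (auto simp: image_iff) (metis minus_minus vector_sneg_minus1 vector_smult_lneg)+
    then show ?thesis using x by (simp add: proj_action_span complexify_uminus_vec)
  qed (simp add: proj_action_def)
qed

lemma proj_action_Bij: "A \<in> carrier OO' \<Longrightarrow> proj_action A \<in> Bij P3"
proof -
  assume A: "A \<in> carrier OO'"
  then obtain B where B: "B \<in> carrier OO'" "A ** B = mat 1" "B ** A = mat 1"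
    using SO_signed_inverse[of A] unfolding carrier_OO'_eq by metis
  have "bij_betw (proj_action A) P3 P3"
    by (rule bij_betw_byWitness[where f' = "proj_action B"])
       (use A B in \<open>auto simp: proj_action_closed proj_action_mult[symmetric] proj_action_one\<close>)
  then show ?thesis by (simp add: Bij_def proj_action_def extensional_def)
qed

section \<open>Passing to the quotient by \<plusminus>1\<close>

lemma coset_action_r_coset: "coset_action (plus_minus_one #>\<^bsub>OO'\<^esub> A) = proj_action A"
  by (rule ext) (simp add: coset_action_def r_coset_plus_minus_one proj_action_uminus, simp add: proj_action_def)

lemma carrier_OO'_mod: "carrier OO'_mod = (\<lambda>A. plus_minus_one #>\<^bsub>OO'\<^esub> A) ` carrier OO'"
  by (auto simp: FactGroup_def RCOSETS_def)

lemma mult_OO'_mod: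
  assumes "A \<in> carrier OO'" "B \<in> carrier OO'"
  shows "(plus_minus_one #>\<^bsub>OO'\<^esub> A) \<otimes>\<^bsub>OO'_mod\<^esub> (plus_minus_one #>\<^bsub>OO'\<^esub> B) = plus_minus_one #>\<^bsub>OO'\<^esub> (A ** B)"
  using normal.rcos_sum[OF normal_plus_minus_one assms] by (simp add: FactGroup_def)

lemma group_OO'_mod: "group OO'_mod"
  by (rule normal.factorgroup_is_group[OF normal_plus_minus_one])

lemma group_action_OO'_mod: "group_action OO'_mod P3 coset_action"
proof (rule group_action.intro, rule group_hom.intro)
  show "group OO'_mod" by (rule group_OO'_mod)
  show "group (BijGroup P3)" by (rule group_BijGroup)
  show "group_hom_axioms OO'_mod (BijGroup P3) coset_action"
  proof (rule group_hom_axioms.intro, rule homI)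
    fix C assume "C \<in> carrier OO'_mod"
    then show "coset_action C \<in> carrier (BijGroup P3)"
      by (auto simp: carrier_OO'_mod coset_action_r_coset BijGroup_def proj_action_Bij)
  next
    fix C D assume "C \<in> carrier OO'_mod" "D \<in> carrier OO'_mod"
    then obtain A B where AB: "A \<in> carrier OO'" "B \<in> carrier OO'"
      "C = plus_minus_one #>\<^bsub>OO'\<^esub> A" "D = plus_minus_one #>\<^bsub>OO'\<^esub> B"
      unfolding carrier_OO'_mod by blast
    have "proj_action (A ** B) = compose P3 (proj_action A) (proj_action B)"
      using AB(2) by (simp add: fun_eq_iff compose_def restrict_def proj_action_mult) (simp add: proj_action_def)
    then show "coset_action (C \<otimes>\<^bsub>OO'_mod\<^esub> D) = coset_action C \<otimes>\<^bsub>BijGroup P3\<^esub> coset_action D"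
      unfolding AB(3,4) mult_OO'_mod[OF AB(1,2)] coset_action_r_coset
      using AB(1,2) by (simp add: BijGroup_def proj_action_Bij)
  qed
qed

text \<open>The nodes are claimed to be an orbit of \<open>OO'\<close>, while the orbit-stabilizer
  theorem is applied to the quotient; a coset acts as its members do.\<close>

lemma orbit_OO'_mod: "orbit OO'_mod coset_action L = orbit OO' proj_action L"
proof -
  have "orbit OO'_mod coset_action L = (\<lambda>C. coset_action C L) ` carrier OO'_mod"
    by (auto simp: orbit_def)
  also have "\<dots> = (\<lambda>A. proj_action A L) ` carrier OO'"
    by (simp only: carrier_OO'_mod image_image coset_action_r_coset)
  also have "\<dots> = orbit OO' proj_action L"
    by (auto simp: orbit_def)
  finally show ?thesis .
qed

text \<open>Conjugation by g is the isomorphism. It lets the fix group of one node determine those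
  of its whole orbit.\<close>

lemma (in group_action) stabilizer_conj_iso:
  assumes x: "x \<in> E" and g: "g \<in> carrier G"
  shows "G\<lparr>carrier := stabilizer G \<phi> x\<rparr> \<cong> G\<lparr>carrier := stabilizer G \<phi> (\<phi> g x)\<rparr>"
proof -
  interpret group G using group_hom group_hom.axioms(1) by auto
  have gx: "\<phi> g x \<in> E" using element_image[OF g x] by simp
  have ret: "\<phi> (inv g) (\<phi> g x) = x" using orbit_sym_aux[OF g x] by simp
  have conj: "g' \<otimes> h \<otimes> inv g' \<in> stabilizer G \<phi> (\<phi> g' y)"
    if "y \<in> E" "g' \<in> carrier G" "h \<in> stabilizer G \<phi> y" for g' h y
  proof -
    have h: "h \<in> carrier G" "\<phi> h y = y" using that by (auto simp: stabilizer_def)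
    have gy: "\<phi> g' y \<in> E" using element_image that by blast
    have "\<phi> (inv g') (\<phi> g' y) = y" using orbit_sym_aux that by blast
    then have "\<phi> (g' \<otimes> h \<otimes> inv g') (\<phi> g' y) = \<phi> g' y"
      using that h gy by (simp add: composition_rule)
    then show ?thesis using that h by (simp add: stabilizer_def)
  qed
  let ?f = "\<lambda>h. g \<otimes> h \<otimes> inv g"
  have sub: "h \<in> carrier G" if "h \<in> stabilizer G \<phi> y" for h y
    using that by (simp add: stabilizer_def)
  have cancel: "g \<otimes> (inv g \<otimes> a) = a" "inv g \<otimes> (g \<otimes> a) = a" if "a \<in> carrier G" for a
    using that g by (simp_all add: m_assoc[symmetric])
  have "bij_betw ?f (stabilizer G \<phi> x) (stabilizer G \<phi> (\<phi> g x))"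
  proof (rule bij_betw_byWitness[where f' = "\<lambda>h. inv g \<otimes> h \<otimes> g"])
    show "?f ` stabilizer G \<phi> x \<subseteq> stabilizer G \<phi> (\<phi> g x)"
      using conj[OF x g] by blast
    show "(\<lambda>h. inv g \<otimes> h \<otimes> g) ` stabilizer G \<phi> (\<phi> g x) \<subseteq> stabilizer G \<phi> x"
      using conj[OF gx, of "inv g"] g ret by auto
  qed (use g in \<open>auto simp: m_assoc cancel dest!: sub\<close>)
  moreover have "?f (h \<otimes> k) = ?f h \<otimes> ?f k"
    if "h \<in> carrier G" "k \<in> carrier G" for h k
    using that g by (simp add: m_assoc cancel)
  ultimately have "?f \<in> iso (G\<lparr>carrier := stabilizer G \<phi> x\<rparr>) (G\<lparr>carrier := stabilizer G \<phi> (\<phi> g x)\<rparr>)"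
    using conj[OF x g] sub[of _ x] by (simp add: iso_def hom_def)
  then show ?thesis by (auto simp: is_iso_def)
qed

text \<open>Passing from matrices to cosets stays injective because only the identity goes to
  \<plusminus>1. Orbit-stabilizer in the quotient of order 96 and the hypothesis \<open>card\<close>
  give the fix group as many elements as \<open>H\<close>, so the image is all of it.\<close>

lemma fix_group_iso:
  assumes H: "group H" "finite (carrier H)"
    and hom: "\<psi> \<in> hom H OO'"
    and L: "L \<in> P3"
    and fix_L: "\<And>h. h \<in> carrier H \<Longrightarrow> proj_action (\<psi> h) L = L"
    and inj: "\<And>h. h \<in> carrier H \<Longrightarrow> \<psi> h = mat 1 \<or> \<psi> h = - mat 1 \<Longrightarrow> h = \<one>\<^bsub>H\<^esub>"
    and card: "card (orbit OO' proj_action L) * order H = 96"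
  shows "fix_group L \<cong> H"
proof -
  let ?S = "stabilizer OO'_mod coset_action L"
  let ?\<Psi> = "\<lambda>h. plus_minus_one #>\<^bsub>OO'\<^esub> \<psi> h"
  have \<psi>: "\<psi> h \<in> carrier OO'" if "h \<in> carrier H" for h
    using hom that by (auto simp: hom_def)
  have "?\<Psi> \<in> hom H OO'_mod"
  proof (rule homI)
    show "?\<Psi> h \<in> carrier OO'_mod" if "h \<in> carrier H" for h
      using \<psi>[OF that] unfolding carrier_OO'_mod by (rule imageI)
    show "?\<Psi> (h \<otimes>\<^bsub>H\<^esub> k) = ?\<Psi> h \<otimes>\<^bsub>OO'_mod\<^esub> ?\<Psi> k" if "h \<in> carrier H" "k \<in> carrier H" for h k
      unfolding mult_OO'_mod[OF \<psi>[OF that(1)] \<psi>[OF that(2)]] using hom that by (simp add: hom_def)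
  qed
  then interpret \<Psi>: group_hom H OO'_mod ?\<Psi>
    using H group_OO'_mod by (simp add: group_hom_def group_hom_axioms_def)
  have "inj_on ?\<Psi> (carrier H)"
  proof (rule \<Psi>.trivial_ker_imp_inj)
    show "kernel H OO'_mod ?\<Psi> = {\<one>\<^bsub>H\<^esub>}"
    proof (intro equalityI subsetI)
      fix h assume "h \<in> kernel H OO'_mod ?\<Psi>"
      then have h: "h \<in> carrier H" "{\<psi> h, - \<psi> h} = plus_minus_one"
        by (auto simp: kernel_def FactGroup_def r_coset_plus_minus_one)
      have "\<psi> h = mat 1 \<or> \<psi> h = - mat 1"
        using h(2) by blast
      with inj h(1) show "h \<in> {\<one>\<^bsub>H\<^esub>}" by simp
    next
      fix h assume "h \<in> {\<one>\<^bsub>H\<^esub>}"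
      then show "h \<in> kernel H OO'_mod ?\<Psi>"
        using \<Psi>.hom_one \<Psi>.one_closed unfolding kernel_def by blast
    qed
  qed
  moreover have sub: "?\<Psi> h \<in> ?S" if "h \<in> carrier H" for h
    using fix_L[OF that] \<psi>[OF that] unfolding stabilizer_def carrier_OO'_mod
    by (simp add: coset_action_r_coset)
  moreover have "?\<Psi> ` carrier H = ?S"
  proof (rule card_subset_eq)
    have "card (orbit OO'_mod coset_action L) * card ?S = 96"
      using group_action.orbit_stabilizer_theorem[OF group_action_OO'_mod L] order_OO'_mod by simp
    then have cards: "card (orbit OO' proj_action L) * card ?S = 96"
      by (simp only: orbit_OO'_mod)
    then have "card ?S = order H"
      using card by (metis mult_cancel1 mult_is_0 zero_neq_numeral)
    then show "card (?\<Psi> ` carrier H) = card ?S"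
      using calculation(1) by (simp add: card_image order_def)
    \<comment> \<open>Infinite sets have \<open>card\<close> 0, which the product 96
      excludes.\<close>
    show "finite ?S"
      using cards by (intro card_ge_0_finite) (metis gr0I mult_is_0 zero_neq_numeral)
    show "?\<Psi> ` carrier H \<subseteq> ?S"
      using sub by blast
  qed
  ultimately have "?\<Psi> \<in> iso H (fix_group L)"
    using \<Psi>.hom_mult by (auto simp: iso_def hom_def fix_group_def bij_betw_def)
  then show ?thesis
    using group.iso_sym[OF H(1)] by (auto simp: is_iso_def)
qed

lemma fix_group_iso_on_orbit:
  assumes "L \<in> P3" "fix_group L \<cong> H" "order H = m" "finite (carrier H)"
    and P: "P \<in> orbit OO' proj_action L"
  shows "fix_group P \<cong> H \<and> order (fix_group P) = m"
proof -
  have "P \<in> orbit OO'_mod coset_action L"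
    using P by (simp only: orbit_OO'_mod)
  then obtain C where C: "C \<in> carrier OO'_mod" "P = coset_action C L"
    by (auto simp: orbit_def)
  have "fix_group L \<cong> fix_group P"
    unfolding fix_group_def C(2)
    by (rule group_action.stabilizer_conj_iso[OF group_action_OO'_mod assms(1) C(1)])
  moreover have "group (fix_group L)"
    unfolding fix_group_def
    by (rule subgroup.subgroup_is_group[OF _ group_OO'_mod])
       (rule group_action.stabilizer_subgroup[OF group_action_OO'_mod assms(1)])
  ultimately have "fix_group P \<cong> H"
    using assms(2) group.iso_sym iso_trans by blast
  then show ?thesis
    using assms(3) iso_same_card by (auto simp: order_def)
qed

section \<open>The nodes of the quartics\<close>

lemma three_eq_zero: "(3::3) = 0"
  by simp

lemma all3: "(\<forall>i::3. P i) \<longleftrightarrow> P 0 \<and> P 1 \<and> P 2"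
  by (subst forall_3, subst three_eq_zero) auto

lemma cases3: obtains "(j::3) = 0" | "j = 1" | "j = 2"
  using all3[of "\<lambda>j. j = 0 \<or> j = 1 \<or> j = 2"] by auto

lemma chart_nth:
  "chart i y $ i = 1" "chart i y $ (i + 1) = y $ 0" "chart i y $ (i + 2) = y $ 1" "chart i y $ (i + 3) = y $ 2"
  by (cases i rule: cases4; simp add: chart_def axis_def)+

lemma numerals_mod_4: "(4::4) = 0" "(5::4) = 1" "(6::4) = 2"
  by simp_all

lemma sum4_shift: "sum f (UNIV::4 set) = f i + f (i + 1) + f (i + 2) + f (i + 3)"
  by (cases i rule: cases4) (simp_all add: sum4 numerals_mod_4 ac_simps)

definition affine_q :: "complex^3 \<Rightarrow> complex" where
  "affine_q y = 1 + (y$0)\<^sup>2 + (y$1)\<^sup>2 + (y$2)\<^sup>2"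

text \<open>The quartic is symmetric in its variables, so every chart gives this same polynomial and
  one computation covers all four.\<close>

definition affine_quartic :: "complex \<Rightarrow> complex^3 \<Rightarrow> complex" where
  "affine_quartic l y = 1 + (y$0)^4 + (y$1)^4 + (y$2)^4 + l * (affine_q y)\<^sup>2"

lemma q_form_chart: "q_form (chart i y) = affine_q y"
  unfolding q_form_def affine_q_def by (subst sum4_shift[of _ i]) (simp add: chart_nth)

lemma quartic_chart: "(\<lambda>y. quartic l (chart i y)) = affine_quartic l"
  unfolding quartic_def q_form_chart f0_def affine_quartic_def
  by (subst sum4_shift[of _ i]) (simp add: chart_nth)

lemma affine_q_line: "affine_q (a + axis j t) = affine_q a + 2 * a$j * t + t\<^sup>2"
  by (cases j rule: cases3) (simp_all add: affine_q_def axis_def power2_eq_square algebra_simps)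

lemma partial_affine_quartic:
  "partial j (affine_quartic l) = (\<lambda>a. 4 * (a$j)^3 + 4 * l * affine_q a * a$j)"
proof
  fix a :: "complex^3"
  \<comment> \<open>Only coordinate j moves, so the restriction is an explicit polynomial in
    t.\<close>
  have line: "affine_quartic l (a + axis j t) =
      1 + ((a$0)^4 + (a$1)^4 + (a$2)^4 - (a$j)^4 + (a$j + t)^4) + l * (affine_q a + 2 * a$j * t + t\<^sup>2)\<^sup>2" for t
    unfolding affine_quartic_def affine_q_line by (cases j rule: cases3) (simp_all add: axis_def)
  have "((\<lambda>t. affine_quartic l (a + axis j t)) has_field_derivative
      4 * (a$j)^3 + 4 * l * affine_q a * a$j) (at 0)"
    unfolding line by (auto intro!: derivative_eq_intros simp: algebra_simps)
  then show "partial j (affine_quartic l) a = 4 * (a$j)^3 + 4 * l * affine_q a * a$j"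
    unfolding partial_def by (rule DERIV_imp_deriv)
qed

lemma partial_partial_affine_quartic:
  "partial j (partial k (affine_quartic l)) a =
     (if j = k then 12 * (a$k)\<^sup>2 + 4 * l * affine_q a else 0) + 8 * l * a$j * a$k"
proof -
  let ?d = "if j = k then 1 else 0 :: complex"
  have "(a + axis j t) $ k = a$k + ?d * t" for t
    by (simp add: axis_def)
  then have "((\<lambda>t. 4 * ((a + axis j t) $ k)^3 + 4 * l * affine_q (a + axis j t) * (a + axis j t) $ k)
      has_field_derivative ?d * (12 * (a$k)\<^sup>2 + 4 * l * affine_q a) + 8 * l * a$j * a$k) (at 0)"
    unfolding affine_q_line
    by (auto intro!: derivative_eq_intros simp: algebra_simps)
  then have "partial j (partial k (affine_quartic l)) a =
      ?d * (12 * (a$k)\<^sup>2 + 4 * l * affine_q a) + 8 * l * a$j * a$k"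
    unfolding partial_affine_quartic unfolding partial_def by (rule DERIV_imp_deriv)
  then show ?thesis by auto
qed

text \<open>The rank-one update formula det(D + c v v^T) = det D + c v^T adj(D) v. The Hessian at a
  node has this shape.\<close>

lemma det_diagonal_plus_rank_one:
  fixes d v :: "3 \<Rightarrow> 'a::comm_ring_1"
  shows "det ((\<chi> i j. (if i = j then d j else 0) + c * v i * v j) :: 'a^3^3) =
    d 0 * d 1 * d 2 + c * ((v 0)\<^sup>2 * d 1 * d 2 + d 0 * (v 1)\<^sup>2 * d 2 + d 0 * d 1 * (v 2)\<^sup>2)"
  by (simp add: det_3 three_eq_zero power2_eq_square algebra_simps)

text \<open>With Q the value of \<open>affine_q\<close>, the critical equations are a_j^3 = (Q/k)
  a_j. Multiplied by a_j, they turn the quartic into 1 - Q/k; hence Q = k and a_j^3 = a_j.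
  Conversely, if m = k - 1 of the a_j are \<plusminus>1 and the others 0, the Hessian has
  determinant 8^m (-4)^(3-m) / k.\<close>

lemma double_point_affine_quartic_iff:
  assumes k: "k \<noteq> 0"
  shows "ordinary_double_point (affine_quartic (-1 / k)) a \<longleftrightarrow>
    (\<forall>j. a$j = 0 \<or> a$j = 1 \<or> a$j = -1) \<and> affine_q a = k" (is "?odp \<longleftrightarrow> ?sgn \<and> _")
proof
  assume odp: ?odp
  define Q where "Q = affine_q a"
  have Q: "Q = 1 + (a$0)\<^sup>2 + (a$1)\<^sup>2 + (a$2)\<^sup>2" by (simp add: Q_def affine_q_def)
  have crit: "(a$j)^3 = Q / k * a$j" for j
  proof -
    have "partial j (affine_quartic (-1 / k)) a = 0"
      using odp by (simp add: ordinary_double_point_def)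
    then have "4 * (a$j)^3 = 4 * (Q / k * a$j)"
      by (simp add: partial_affine_quartic Q_def[symmetric] algebra_simps)
    then show ?thesis using mult_cancel_left[of 4 "(a$j)^3" "Q / k * a$j"] by simp
  qed
  have "(a$j)^4 = Q / k * (a$j)\<^sup>2" for j
    using arg_cong[OF crit[of j], of "\<lambda>z. z * a$j"]
    by (simp add: power2_eq_square power3_eq_cube power4_eq_xxxx mult.assoc)
  then have "affine_quartic (-1 / k) a = 1 + Q / k * ((a$0)\<^sup>2 + (a$1)\<^sup>2 + (a$2)\<^sup>2) - Q / k * Q"
    by (simp add: affine_quartic_def Q_def[symmetric] algebra_simps power2_eq_square)
  also have "\<dots> = 1 - Q / k"
  proof -
    have "(a$0)\<^sup>2 + (a$1)\<^sup>2 + (a$2)\<^sup>2 = Q - 1" unfolding Q by simp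
    then show ?thesis by (simp add: right_diff_distrib)
  qed
  finally have "Q = k"
    using odp k by (simp add: ordinary_double_point_def)
  moreover have "a$j = 0 \<or> a$j = 1 \<or> a$j = -1" for j
  proof -
    have "a$j * ((a$j - 1) * (a$j + 1)) = 0"
      using crit[of j] k \<open>Q = k\<close> by (simp add: power3_eq_cube algebra_simps)
    then show ?thesis by (auto simp: add_eq_0_iff2)
  qed
  ultimately show "?sgn \<and> affine_q a = k" by (simp add: Q_def)
next
  assume a: "?sgn \<and> affine_q a = k"
  have sq: "(a$j)^3 = a$j" "(a$j)^4 = (a$j)\<^sup>2" for j
    using a[THEN conjunct1, rule_format, of j] by auto
  have "affine_quartic (-1 / k) a = 0"
    using a k by (simp add: affine_quartic_def sq power2_eq_square affine_q_def)
  moreover have "partial j (affine_quartic (-1 / k)) a = 0" for j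
    using a k by (simp add: partial_affine_quartic sq)
  moreover have "det (\<chi> i j. partial i (partial j (affine_quartic (-1 / k))) a) \<noteq> 0"
  proof -
    have sq01: "(a$j)\<^sup>2 = 0 \<or> (a$j)\<^sup>2 = 1" for j
      using a[THEN conjunct1, rule_format, of j] by auto
    have "(\<chi> i j. partial i (partial j (affine_quartic (-1 / k))) a) =
        (\<chi> i j. (if i = j then 12 * (a$j)\<^sup>2 - 4 else 0) + (- 8 / k) * a$i * a$j)"
      using a k by (simp add: vec_eq_iff partial_partial_affine_quartic)
    then have det: "det (\<chi> i j. partial i (partial j (affine_quartic (-1 / k))) a) =
        (12 * (a$0)\<^sup>2 - 4) * (12 * (a$1)\<^sup>2 - 4) * (12 * (a$2)\<^sup>2 - 4) + (- 8 / k) *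
        ((a$0)\<^sup>2 * (12 * (a$1)\<^sup>2 - 4) * (12 * (a$2)\<^sup>2 - 4) + (12 * (a$0)\<^sup>2 - 4) * (a$1)\<^sup>2 * (12 * (a$2)\<^sup>2 - 4)
          + (12 * (a$0)\<^sup>2 - 4) * (12 * (a$1)\<^sup>2 - 4) * (a$2)\<^sup>2)"
      by (simp only: det_diagonal_plus_rank_one)
    have k_eq: "k = 1 + (a$0)\<^sup>2 + (a$1)\<^sup>2 + (a$2)\<^sup>2"
      using a by (simp add: affine_q_def)
    \<comment> \<open>Once k is expressed by the squares, each of the eight possible supports of a
      leaves a numerical determinant.\<close>
    show ?thesis
      unfolding det unfolding k_eq using sq01[of 0] sq01[of 1] sq01[of 2]
      by (elim disjE) (simp_all only:, simp_all)
  qed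
  ultimately show ?odp by (simp add: ordinary_double_point_def)
qed

section \<open>From affine charts to homogeneous coordinates\<close>

definition sign_points :: "nat \<Rightarrow> (complex^4) set" where
  "sign_points k = {x. (\<forall>i. x$i = 0 \<or> x$i = 1 \<or> x$i = -1) \<and> q_form x = of_nat k}"

lemma span_singleton_scale: "c \<noteq> 0 \<Longrightarrow> vec.span {c *s x} = vec.span {x}" for x :: "'a::field^'n"
proof (cases "x = 0")
  case False
  assume "c \<noteq> 0"
  with False show ?thesis by (subst span_singleton_eq_iff) auto
qed simp

lemma all4_shift: "(\<forall>j::4. P j) \<longleftrightarrow> P i \<and> P (i + 1) \<and> P (i + 2) \<and> P (i + 3)"
  by (cases i rule: cases4) (auto simp: all4 numerals_mod_4)

lemma nodes_eq:
  assumes "k > 0"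
  shows "nodes (quartic (-1 / of_nat k)) = (\<lambda>x. vec.span {x}) ` sign_points k"
proof -
  have odp: "ordinary_double_point (\<lambda>y. quartic (-1 / of_nat k) (chart i y)) a \<longleftrightarrow> chart i a \<in> sign_points k" for i a
    using assms unfolding quartic_chart sign_points_def q_form_chart
    by (subst double_point_affine_quartic_iff) (simp_all add: all4_shift[of _ i] chart_nth all3 q_form_chart)
  show ?thesis
  proof (intro equalityI subsetI)
    fix L assume "L \<in> nodes (quartic (-1 / of_nat k))"
    then show "L \<in> (\<lambda>x. vec.span {x}) ` sign_points k"
      unfolding nodes_def odp by blast
  next
    fix L assume "L \<in> (\<lambda>x. vec.span {x}) ` sign_points k"
    then obtain x where L: "L = vec.span {x}" and x: "x \<in> sign_points k" by blast
    have "x \<noteq> 0"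
      using x assms by (auto simp: sign_points_def q_form_def)
    then obtain i where i: "x$i \<noteq> 0" by (auto simp: vec_eq_iff)
    \<comment> \<open>Since x_i is \<plusminus>1, multiplying by it is dividing by it: coordinate i
      becomes 1 and the line stays the same.\<close>
    define a :: "complex^3" where
      "a = (\<chi> j. x$i * (if j = 0 then x$(i+1) else if j = 1 then x$(i+2) else x$(i+3)))"
    have sgn: "x$j = 0 \<or> x$j = 1 \<or> x$j = -1" for j
      using x by (simp add: sign_points_def)
    have chart: "chart i a = x$i *s x"
      using sgn[of i] i by (auto simp: vec_eq_iff all4_shift[of _ i] chart_nth a_def)
    have "q_form (x$i *s x) = q_form x"
      using sgn[of i] i by (auto simp: q_form_def)
    then have "x$i *s x \<in> sign_points k"
      using sgn i x by (simp add: sign_points_def) (metis mult_minus_left mult_1 minus_minus mult_zero_right)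
    then have "vec.span {chart i a} \<in> nodes (quartic (-1 / of_nat k))"
      unfolding nodes_def odp chart[symmetric] by blast
    then show "L \<in> nodes (quartic (-1 / of_nat k))"
      unfolding L chart using i by (simp add: span_singleton_scale)
  qed
qed

section \<open>Transitivity and counting\<close>

definition indicator_vec :: "4 set \<Rightarrow> complex^4" where
  "indicator_vec S = (\<chi> i. if i \<in> S then 1 else 0)"

lemma complexify_signed_perm_vec: "(complexify (signed_perm \<sigma> \<epsilon>) *v x) $ i = of_real (\<epsilon> i) * x $ \<sigma> i"
proof -
  have "(\<Sum>j\<in>UNIV. complex_of_real (if j = \<sigma> i then \<epsilon> i else 0) * x $ j)
      = (\<Sum>j\<in>UNIV. if j = \<sigma> i then of_real (\<epsilon> i) * x $ \<sigma> i else 0)"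
    by (rule sum.cong) auto
  then show ?thesis by (simp add: complexify_def signed_perm_def matrix_vector_mult_def)
qed

lemma q_form_sign_vector:
  assumes "\<forall>i. x$i = 0 \<or> x$i = 1 \<or> x$i = -1"
  shows "q_form x = of_nat (card {i. x$i \<noteq> 0})"
proof -
  have "(x$i)\<^sup>2 = (if x$i \<noteq> 0 then 1 else 0)" for i
    using assms[rule_format, of i] by auto
  then show ?thesis by (simp add: q_form_def sum.If_cases)
qed

lemma sign_points_eq:
  "sign_points k = {x. (\<forall>i. x$i = 0 \<or> x$i = 1 \<or> x$i = -1) \<and> card {i. x$i \<noteq> 0} = k}"
  unfolding sign_points_def using q_form_sign_vector by auto

text \<open>A bijection of the two sets is glued to one of their complements, which have equal size
  because the type is finite.\<close>

lemma ex_bij_mapping_set: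
  assumes "finite (UNIV :: 'a set)" "card S = card (T :: 'a set)"
  obtains \<sigma> :: "'a \<Rightarrow> 'a" where "bij \<sigma>" "\<And>i. \<sigma> i \<in> T \<longleftrightarrow> i \<in> S"
proof -
  have fin: "finite A" for A :: "'a set" using assms(1) by (rule finite_subset[rotated]) simp
  obtain f where f: "bij_betw f S T"
    using finite_same_card_bij[OF fin fin assms(2)] by blast
  have "card (- S) = card (- T)"
    using assms(2) by (simp add: Compl_eq_Diff_UNIV card_Diff_subset fin)
  then obtain g where g: "bij_betw g (- S) (- T)"
    using finite_same_card_bij[OF fin fin] by blast
  define \<sigma> where "\<sigma> i = (if i \<in> S then f i else g i)" for i
  have "bij_betw \<sigma> S T"
    using f by (rule bij_betw_cong[THEN iffD1, rotated]) (simp add: \<sigma>_def)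
  moreover have "bij_betw \<sigma> (- S) (- T)"
    using g by (rule bij_betw_cong[THEN iffD1, rotated]) (simp add: \<sigma>_def)
  ultimately have "bij_betw \<sigma> (S \<union> - S) (T \<union> - T)"
    by (rule bij_betw_combine) simp
  then have "bij \<sigma>" by (simp add: Compl_partition)
  moreover have "\<sigma> i \<in> T \<longleftrightarrow> i \<in> S" for i
    using f g unfolding \<sigma>_def by (auto dest: bij_betwE)
  ultimately show thesis by (rule that)
qed

lemma signed_perm_maps_sign_points:
  assumes "bij \<sigma>" "\<forall>i. \<epsilon> i = 1 \<or> \<epsilon> i = -1" "x \<in> sign_points k"
  shows "complexify (signed_perm \<sigma> \<epsilon>) *v x \<in> sign_points k"
proof -
  let ?y = "complexify (signed_perm \<sigma> \<epsilon>) *v x"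
  have y: "?y $ i = x $ \<sigma> i \<or> ?y $ i = - x $ \<sigma> i" for i
    using assms(2)[rule_format, of i] by (auto simp: complexify_signed_perm_vec)
  have "(?y $ i)\<^sup>2 = (x $ \<sigma> i)\<^sup>2" for i
    using y[of i] by auto
  then have "q_form ?y = q_form x"
    unfolding q_form_def using assms(1) sum.reindex_bij_betw[of \<sigma> UNIV UNIV "\<lambda>i. (x$i)\<^sup>2"] by simp
  moreover have "?y $ i = 0 \<or> ?y $ i = 1 \<or> ?y $ i = -1" for i
  proof -
    have "x $ \<sigma> i = 0 \<or> x $ \<sigma> i = 1 \<or> x $ \<sigma> i = -1"
      using assms(3) by (simp add: sign_points_def)
    then show ?thesis using y[of i] by auto
  qed
  ultimately show ?thesis
    using assms(3) by (simp add: sign_points_def)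
qed

lemma indicator_vec_in_sign_points: "indicator_vec S \<in> sign_points (card S)"
  by (simp add: sign_points_eq indicator_vec_def)

lemma indicator_vec_nonzero: "S \<noteq> {} \<Longrightarrow> indicator_vec S \<noteq> 0"
  by (auto simp: indicator_vec_def vec_eq_iff)

text \<open>A transposition that fixes the base vector corrects the determinant.\<close>

lemma SO_signed_transitive:
  assumes y: "y \<in> sign_points (card S)" and ab: "a \<noteq> b" "a \<in> S \<longleftrightarrow> b \<in> S"
  shows "\<exists>A \<in> SO_signed. complexify A *v indicator_vec S = y"
proof -
  have sgn: "y$i = 0 \<or> y$i = 1 \<or> y$i = -1" for i
    using y by (simp add: sign_points_def)
  have "card {i. y$i \<noteq> 0} = card S"
    using y by (simp add: sign_points_eq)
  then obtain \<sigma> where \<sigma>: "bij \<sigma>" "\<And>i. \<sigma> i \<in> S \<longleftrightarrow> y$i \<noteq> 0"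
    using ex_bij_mapping_set[of "{i. y$i \<noteq> 0}" S] by auto
  \<comment> \<open>Where y vanishes either sign would do; the default is 1.\<close>
  define \<epsilon> where "\<epsilon> i = (if y$i = -1 then -1 else 1 :: real)" for i
  let ?t = "Transposition.transpose a b"
  have map: "complexify (signed_perm \<tau> \<epsilon>) *v indicator_vec S = y" if "\<And>i. \<tau> i \<in> S \<longleftrightarrow> \<sigma> i \<in> S" for \<tau>
    using sgn by (auto simp: vec_eq_iff complexify_signed_perm_vec indicator_vec_def \<epsilon>_def that \<sigma>(2))
  have t: "(?t \<circ> \<sigma>) i \<in> S \<longleftrightarrow> \<sigma> i \<in> S" for i
    using ab(2) by (simp add: Transposition.transpose_def)
  have eps: "\<epsilon> i = 1 \<or> \<epsilon> i = -1" for i by (simp add: \<epsilon>_def)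
  have "prod \<epsilon> UNIV = 1 \<or> prod \<epsilon> UNIV = -1"
    unfolding prod4 by (intro signs_mult eps)
  then have "prod \<epsilon> UNIV = of_int (sign \<sigma>) \<or> prod \<epsilon> UNIV = of_int (sign (?t \<circ> \<sigma>))"
    using sign_cases[of \<sigma>] ab(1) by (auto simp: sign_compose_UNIV \<sigma>(1) sign_swap_id)
  then show ?thesis
  proof
    assume "prod \<epsilon> UNIV = of_int (sign \<sigma>)"
    then have "signed_perm \<sigma> \<epsilon> \<in> SO_signed"
      using \<sigma>(1) eps by (intro SO_signedI[OF _ _ _ refl])
    then show ?thesis using map[of \<sigma>] by blast
  next
    assume "prod \<epsilon> UNIV = of_int (sign (?t \<circ> \<sigma>))"
    then have "signed_perm (?t \<circ> \<sigma>) \<epsilon> \<in> SO_signed"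
      using \<sigma>(1) eps by (intro SO_signedI[OF _ _ _ refl]) (simp_all add: bij_comp)
    then show ?thesis using map[OF t] by blast
  qed
qed

text \<open>The indices a and b provide the transposition that corrects the determinant. Among four
  indices, every S has such a pair, inside or outside it.\<close>

lemma orbit_indicator_vec:
  assumes "S \<noteq> {}" "a \<noteq> b" "a \<in> S \<longleftrightarrow> b \<in> S"
  shows "orbit OO' proj_action (vec.span {indicator_vec S}) = (\<lambda>x. vec.span {x}) ` sign_points (card S)"
proof -
  have "orbit OO' proj_action (vec.span {indicator_vec S})
      = (\<lambda>A. vec.span {complexify A *v indicator_vec S}) ` SO_signed"
    using indicator_vec_nonzero[OF assms(1)] by (auto simp: orbit_def carrier_OO'_eq proj_action_span)
  also have "\<dots> = (\<lambda>x. vec.span {x}) ` ((\<lambda>A. complexify A *v indicator_vec S) ` SO_signed)"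
    by (simp only: image_image)
  also have "(\<lambda>A. complexify A *v indicator_vec S) ` SO_signed = sign_points (card S)"
  proof (intro equalityI subsetI)
    fix y assume "y \<in> (\<lambda>A. complexify A *v indicator_vec S) ` SO_signed"
    then obtain \<sigma> \<epsilon> where "bij \<sigma>" "\<forall>i. \<epsilon> i = 1 \<or> \<epsilon> i = -1"
        "y = complexify (signed_perm \<sigma> \<epsilon>) *v indicator_vec S"
      unfolding SO_signed_def by blast
    then show "y \<in> sign_points (card S)"
      using signed_perm_maps_sign_points indicator_vec_in_sign_points by simp
  next
    fix y assume "y \<in> sign_points (card S)"
    from SO_signed_transitive[OF this assms(2,3)]
    show "y \<in> (\<lambda>A. complexify A *v indicator_vec S) ` SO_signed" by blast
  qed
  finally show ?thesis .
qed

text \<open>Integer tuples can be enumerated by evaluation, which complex lines do not permit; this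
  carries the count over.\<close>

definition int_vec :: "int \<times> int \<times> int \<times> int \<Rightarrow> complex^4" where
  "int_vec t = (case t of (a, b, c, d) \<Rightarrow> \<chi> i. of_int (tuple4 a b c d i))"

lemma int_vec_nth [simp]:
  "int_vec (a, b, c, d) $ 0 = of_int a" "int_vec (a, b, c, d) $ 1 = of_int b"
  "int_vec (a, b, c, d) $ 2 = of_int c" "int_vec (a, b, c, d) $ 3 = of_int d"
  by (simp_all add: int_vec_def)

text \<open>Normalised homogeneous coordinates of the points: the first nonzero coordinate is \<open>1\<close>.\<close>

definition normal_tuples :: "nat \<Rightarrow> (int \<times> int \<times> int \<times> int) set" where
  "normal_tuples k = {t \<in> {0, 1, -1} \<times> {0, 1, -1} \<times> {0, 1, -1} \<times> {0, 1, -1}.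
     case t of (a, b, c, d) \<Rightarrow> a * a + b * b + c * c + d * d = int k \<and>
       (a = 1 \<or> a = 0 \<and> (b = 1 \<or> b = 0 \<and> (c = 1 \<or> c = 0 \<and> d = 1)))}"

lemma card_normal_tuples:
  "card (normal_tuples 1) = 4" "card (normal_tuples 2) = 12"
  "card (normal_tuples 3) = 16" "card (normal_tuples 4) = 8"
  by code_simp+

lemma normal_tuples_iff:
  "(a, b, c, d) \<in> normal_tuples k \<longleftrightarrow>
    (a = 0 \<or> a = 1 \<or> a = -1) \<and> (b = 0 \<or> b = 1 \<or> b = -1) \<and> (c = 0 \<or> c = 1 \<or> c = -1) \<and>
    (d = 0 \<or> d = 1 \<or> d = -1) \<and> a * a + b * b + c * c + d * d = int k \<and>
    (a = 1 \<or> a = 0 \<and> (b = 1 \<or> b = 0 \<and> (c = 1 \<or> c = 0 \<and> d = 1)))"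
  unfolding normal_tuples_def mem_Collect_eq mem_Times_iff insert_iff empty_iff prod.sel prod.case
  by (simp only: conj_assoc simp_thms)

lemma normal_tuples_neg:
  assumes "a = 0 \<or> a = 1 \<or> a = -1" "b = 0 \<or> b = 1 \<or> b = -1" "c = 0 \<or> c = 1 \<or> c = -1" "d = 0 \<or> d = 1 \<or> d = -1"
    and "a * a + b * b + c * c + d * d = int k" "k > 0"
  shows "(a, b, c, d) \<in> normal_tuples k \<or> (- a, - b, - c, - d) \<in> normal_tuples k"
proof -
  have neg: "- x = 0 \<or> - x = 1 \<or> - x = -1" if "x = 0 \<or> x = 1 \<or> x = -1" for x :: int
    using that by auto
  have "(a, b, c, d) \<noteq> (0, 0, 0, 0)" using assms(5,6) by auto
  with assms(1-4) have "(a = 1 \<or> a = 0 \<and> (b = 1 \<or> b = 0 \<and> (c = 1 \<or> c = 0 \<and> d = 1))) \<or>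
      (- a = 1 \<or> - a = 0 \<and> (- b = 1 \<or> - b = 0 \<and> (- c = 1 \<or> - c = 0 \<and> - d = 1)))"
    by (cases "a = 0"; cases "b = 0"; cases "c = 0"; simp; linarith)
  with assms(5) neg[OF assms(1)] neg[OF assms(2)] neg[OF assms(3)] neg[OF assms(4)] assms(1-4)
  show ?thesis unfolding normal_tuples_iff by (simp only: minus_mult_minus simp_thms)
qed

lemma span_sign_points_eq:
  assumes "k > 0"
  shows "(\<lambda>x. vec.span {x}) ` sign_points k = (\<lambda>t. vec.span {int_vec t}) ` normal_tuples k"
proof (intro equalityI subsetI)
  fix L assume "L \<in> (\<lambda>x. vec.span {x}) ` sign_points k"
  then obtain x where L: "L = vec.span {x}" and x: "\<forall>i. x$i = 0 \<or> x$i = 1 \<or> x$i = -1" "q_form x = of_nat k"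
    by (auto simp: sign_points_def)
  have "\<exists>a. (a = 0 \<or> a = 1 \<or> a = -1) \<and> x$i = of_int a" for i
    using x(1)[rule_format, of i] by (metis of_int_0 of_int_1 of_int_minus)
  then obtain a where a: "\<And>i. a i = 0 \<or> a i = 1 \<or> a i = -1" "\<And>i. x$i = of_int (a i)"
    by metis
  have x_eq: "x = int_vec (a 0, a 1, a 2, a 3)" "(-1) *s x = int_vec (- a 0, - a 1, - a 2, - a 3)"
    by (simp_all add: vec4_eq_iff a(2))
  have "of_int (a 0 * a 0 + a 1 * a 1 + a 2 * a 2 + a 3 * a 3) = (of_int (int k) :: complex)"
    using x(2) by (simp add: q_form_def sum4 a(2) power2_eq_square)
  then have k: "a 0 * a 0 + a 1 * a 1 + a 2 * a 2 + a 3 * a 3 = int k"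
    unfolding of_int_eq_iff .
  have "(a 0, a 1, a 2, a 3) \<in> normal_tuples k \<or> (- a 0, - a 1, - a 2, - a 3) \<in> normal_tuples k"
    by (rule normal_tuples_neg) (use a(1) k assms in auto)
  moreover have "L = vec.span {int_vec (a 0, a 1, a 2, a 3)}" "L = vec.span {int_vec (- a 0, - a 1, - a 2, - a 3)}"
    unfolding x_eq[symmetric] L by (rule refl, rule span_singleton_scale[symmetric], simp)
  ultimately show "L \<in> (\<lambda>t. vec.span {int_vec t}) ` normal_tuples k" by blast
next
  fix L assume "L \<in> (\<lambda>t. vec.span {int_vec t}) ` normal_tuples k"
  then obtain a b c d where t: "(a, b, c, d) \<in> normal_tuples k" "L = vec.span {int_vec (a, b, c, d)}"
    by auto
  have tup: "a = 0 \<or> a = 1 \<or> a = -1" "b = 0 \<or> b = 1 \<or> b = -1" "c = 0 \<or> c = 1 \<or> c = -1"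
    "d = 0 \<or> d = 1 \<or> d = -1" "a * a + b * b + c * c + d * d = int k"
    using t(1) unfolding normal_tuples_iff by simp_all
  have "of_int (a * a + b * b + c * c + d * d) = (of_int (int k) :: complex)"
    by (simp only: tup(5))
  then have "q_form (int_vec (a, b, c, d)) = of_nat k"
    by (simp add: q_form_def sum4 power2_eq_square)
  moreover have "of_int x = (0::complex) \<or> of_int x = (1::complex) \<or> of_int x = (-1::complex)"
    if "x = 0 \<or> x = 1 \<or> x = -1" for x
    using that by auto
  then have "\<forall>i. int_vec (a, b, c, d) $ i = 0 \<or> int_vec (a, b, c, d) $ i = 1 \<or> int_vec (a, b, c, d) $ i = -1"
    unfolding all4 int_vec_nth using tup(1-4) by (intro conjI)
  ultimately have "int_vec (a, b, c, d) \<in> sign_points k"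
    by (simp add: sign_points_def)
  then show "L \<in> (\<lambda>x. vec.span {x}) ` sign_points k"
    unfolding t(2) by blast
qed

lemma inj_on_span_int_vec: "inj_on (\<lambda>t. vec.span {int_vec t}) (normal_tuples k)"
proof (rule inj_onI)
  fix s t assume st: "s \<in> normal_tuples k" "t \<in> normal_tuples k" "vec.span {int_vec s} = vec.span {int_vec t}"
  obtain a b c d a' b' c' d' where s: "s = (a, b, c, d)" and t: "t = (a', b', c', d')"
    by (metis prod_cases4)
  have ls: "a = 1 \<or> a = 0 \<and> (b = 1 \<or> b = 0 \<and> (c = 1 \<or> c = 0 \<and> d = 1))"
    using st(1) by (simp add: s normal_tuples_def)
  have lt: "a' = 1 \<or> a' = 0 \<and> (b' = 1 \<or> b' = 0 \<and> (c' = 1 \<or> c' = 0 \<and> d' = 1))"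
    using st(2) by (simp add: t normal_tuples_def)
  have "int_vec s \<noteq> 0"
    using ls by (auto simp: vec4_eq_iff s)
  then obtain z where z: "z \<noteq> 0" "int_vec s = z *s int_vec t"
    using st(3) span_singleton_eq_iff by blast
  then have e: "of_int a = z * of_int a'" "of_int b = z * of_int b'" "of_int c = z * of_int c'" "of_int d = z * of_int d'"
    by (simp_all add: vec4_eq_iff s t)
  \<comment> \<open>Proportional vectors have their first nonzero entry at the same position, and
    there both have 1.\<close>
  then have "z = 1"
    using ls lt z(1) by auto
  then show "s = t" using e by (simp add: s t)
qed

lemma card_span_sign_points:
  "k > 0 \<Longrightarrow> card ((\<lambda>x. vec.span {x}) ` sign_points k) = card (normal_tuples k)"
  unfolding span_sign_points_eq by (rule card_image[OF inj_on_span_int_vec])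

section \<open>Dihedral fix groups\<close>

lemma (in group) conj_int_pow:
  assumes "r \<in> carrier G" "s \<in> carrier G"
  shows "s \<otimes> r [^] (i::int) \<otimes> inv s = (s \<otimes> r \<otimes> inv s) [^] i"
proof -
  have "(\<lambda>x. s \<otimes> x \<otimes> inv s) \<in> hom G G"
  proof (rule homI)
    fix x y assume "x \<in> carrier G" "y \<in> carrier G"
    then have "inv s \<otimes> (s \<otimes> (y \<otimes> inv s)) = y \<otimes> inv s"
      using assms by (simp add: m_assoc[symmetric])
    then show "s \<otimes> (x \<otimes> y) \<otimes> inv s = s \<otimes> x \<otimes> inv s \<otimes> (s \<otimes> y \<otimes> inv s)"
      using \<open>x \<in> carrier G\<close> \<open>y \<in> carrier G\<close> assms by (simp add: m_assoc)
  qed (use assms in simp)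
  from hom_int_pow[OF this assms(1) is_group is_group] show ?thesis .
qed

lemma (in group) int_pow_mod:
  assumes "r \<in> carrier G" "r [^] (n::nat) = \<one>"
  shows "r [^] (k mod int n) = r [^] (k::int)"
proof -
  have "r [^] k = r [^] (int n * (k div int n) + k mod int n)" by simp
  also have "\<dots> = (r [^] int n) [^] (k div int n) \<otimes> r [^] (k mod int n)"
    using assms(1) by (simp only: int_pow_mult int_pow_pow)
  also have "\<dots> = r [^] (k mod int n)"
    using assms by (simp add: int_pow_int)
  finally show ?thesis by simp
qed

text \<open>Pairs encode the normal form r^a s^b. From s r^i s = r^(-i), moving s to the right past
  a power of r inverts that power, which is the multiplication rule of
  \<open>dihedral_group\<close>; reducing exponents modulo n is harmless as r^n = 1.\<close>

lemma (in group) dihedral_hom: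
  assumes r: "r \<in> carrier G" "r [^] n = \<one>" and s: "s \<in> carrier G" "s \<otimes> s = \<one>"
    and sr: "s \<otimes> r \<otimes> s = inv r"
  shows "(\<lambda>(a, b). r [^] a \<otimes> (if b then s else \<one>)) \<in> hom (dihedral_group n) G"
proof (rule homI)
  fix x assume "x \<in> carrier (dihedral_group n)"
  then show "(case x of (a, b) \<Rightarrow> r [^] a \<otimes> (if b then s else \<one>)) \<in> carrier G"
    using r s by (simp split: prod.split)
next
  have "inv s = s" using s by (simp add: inv_equality)
  then have flip: "s \<otimes> r [^] i \<otimes> s = r [^] (- i)" for i :: int
    using conj_int_pow[OF r(1) s(1), of i] r(1) sr by (simp add: int_pow_inv int_pow_neg)
  have flip': "s \<otimes> (r [^] i \<otimes> x) = r [^] (- i) \<otimes> (s \<otimes> x)" if "x \<in> carrier G" for i :: int and x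
  proof -
    have "s \<otimes> (r [^] i \<otimes> x) = s \<otimes> r [^] i \<otimes> (s \<otimes> s) \<otimes> x"
      using that r s(1) unfolding s(2) by (simp add: m_assoc)
    also have "\<dots> = s \<otimes> r [^] i \<otimes> s \<otimes> (s \<otimes> x)"
      using that r s(1) by (simp add: m_assoc)
    finally show ?thesis by (simp only: flip)
  qed
  fix x y assume "x \<in> carrier (dihedral_group n)" "y \<in> carrier (dihedral_group n)"
  obtain a b c d where xy: "x = (a, b)" "y = (c, d)" by (cases x, cases y)
  have add: "r [^] a \<otimes> (r [^] c \<otimes> z) = r [^] (a + c) \<otimes> z" if "z \<in> carrier G" for a c :: int and z
    using that r by (simp add: int_pow_mult m_assoc)
  have add': "r [^] a \<otimes> r [^] c = r [^] (a + c)" for a c :: int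
    using r by (simp add: int_pow_mult)
  have flip'': "s \<otimes> r [^] i = r [^] (- i) \<otimes> s" for i :: int
    using flip'[of \<one> i] r s by simp
  show "(case x \<otimes>\<^bsub>dihedral_group n\<^esub> y of (a, b) \<Rightarrow> r [^] a \<otimes> (if b then s else \<one>)) =
      (case x of (a, b) \<Rightarrow> r [^] a \<otimes> (if b then s else \<one>)) \<otimes> (case y of (a, b) \<Rightarrow> r [^] a \<otimes> (if b then s else \<one>))"
    using r s unfolding xy
    by (simp add: dihedral_group_def int_pow_mod[OF r] m_assoc flip' flip'' add add')
qed

lemma group_dihedral_group:
  assumes "n > 0"
  shows "group (dihedral_group n)"
proof (rule groupI)
  show "\<exists>y\<in>carrier (dihedral_group n). y \<otimes>\<^bsub>dihedral_group n\<^esub> x = \<one>\<^bsub>dihedral_group n\<^esub>"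
    if "x \<in> carrier (dihedral_group n)" for x
  proof -
    obtain a b where x: "x = (a, b)" by (cases x)
    show ?thesis
      using that assms unfolding x
      by (intro bexI[of _ "if b then (a, b) else ((- a) mod int n, b)"]) (auto simp: dihedral_group_def mod_simps)
  qed
qed (use assms in \<open>auto simp: dihedral_group_def mod_simps algebra_simps\<close>)

lemma order_dihedral_group: "order (dihedral_group n) = 2 * n" "finite (carrier (dihedral_group n))"
  by (simp_all add: order_def dihedral_group_def card_cartesian_product)

text \<open>Gathers the node computation, the transitivity and the counting: for each surface only a
  support \<open>S\<close>, a group \<open>H\<close> and a representation fixing the vector of
  \<open>S\<close> have to be supplied.\<close>

lemma node_orbit:
  assumes S: "S \<noteq> {}" "card S = k" "a \<noteq> b" "a \<in> S \<longleftrightarrow> b \<in> S"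
    and H: "group H" "finite (carrier H)" and \<psi>: "\<psi> \<in> hom H OO'"
    and fixed: "\<And>h. h \<in> carrier H \<Longrightarrow> complexify (\<psi> h) *v indicator_vec S = indicator_vec S"
    and inj: "\<And>h. h \<in> carrier H \<Longrightarrow> \<psi> h = mat 1 \<or> \<psi> h = - mat 1 \<Longrightarrow> h = \<one>\<^bsub>H\<^esub>"
    and card: "card (normal_tuples k) * order H = 96"
  shows "nodes (quartic (-1 / of_nat k)) \<in> orbits OO' P3 proj_action \<and>
    card (nodes (quartic (-1 / of_nat k))) = card (normal_tuples k) \<and>
    (\<forall>P\<in>nodes (quartic (-1 / of_nat k)). fix_group P \<cong> H \<and> order (fix_group P) = order H)"
proof -
  let ?L = "vec.span {indicator_vec S}"
  have "k > 0" using S(1,2) by (auto simp: card_gt_0_iff)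
  note nz = indicator_vec_nonzero[OF S(1)]
  have L: "?L \<in> P3" by (rule span_singleton_in_P3[OF nz])
  have nodes: "nodes (quartic (-1 / of_nat k)) = orbit OO' proj_action ?L"
    unfolding nodes_eq[OF \<open>k > 0\<close>] orbit_indicator_vec[OF S(1,3,4)] S(2) ..
  have cardn: "card (nodes (quartic (-1 / of_nat k))) = card (normal_tuples k)"
    unfolding nodes_eq[OF \<open>k > 0\<close>] by (rule card_span_sign_points[OF \<open>k > 0\<close>])
  have "fix_group ?L \<cong> H"
  proof (rule fix_group_iso[OF H \<psi> L _ inj])
    show "proj_action (\<psi> h) ?L = ?L" if "h \<in> carrier H" for h
      using fixed[OF that] by (simp add: proj_action_span nz)
    show "card (orbit OO' proj_action ?L) * order H = 96"
      using card cardn nodes by simp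
  qed
  then have "\<forall>P\<in>orbit OO' proj_action ?L. fix_group P \<cong> H \<and> order (fix_group P) = order H"
    using fix_group_iso_on_orbit[OF L _ refl H(2)] by blast
  moreover have "nodes (quartic (-1 / of_nat k)) \<in> orbits OO' P3 proj_action"
    unfolding nodes orbits_def using L by blast
  ultimately show ?thesis using cardn nodes by simp
qed

lemma complexify_indicator_vec:
  assumes "A *v (\<chi> i. if i \<in> S then 1 else 0) = (\<chi> i. if i \<in> S then 1 else 0)"
  shows "complexify A *v indicator_vec S = indicator_vec S"
proof -
  have "(complexify A *v indicator_vec S) $ i = of_real ((A *v (\<chi> i. if i \<in> S then 1 else 0)) $ i)" for i
    by (simp add: matrix_vector_mult_def complexify_def indicator_vec_def of_real_sum if_distrib[of complex_of_real] cong: if_cong)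
  then show ?thesis
    unfolding assms by (simp add: vec_eq_iff indicator_vec_def)
qed

lemma nat_pow_OO'_vec:
  assumes "A *v v = v"
  shows "(A [^]\<^bsub>OO'\<^esub> (n::nat)) *v v = v"
  by (induction n) (simp_all add: assms matrix_vector_mul_assoc[symmetric])

text \<open>Nontrivial elements are detected on a test vector \<open>v\<close>: only the identity
  may send it to \<open>v\<close> or \<open>- v\<close>. The relation s r s = r^(-1) is stated
  without an inverse so that it can be checked by matrix multiplication.\<close>

lemma node_orbit_dihedral:
  assumes S: "S \<noteq> {}" "card S = k" "a \<noteq> b" "a \<in> S \<longleftrightarrow> b \<in> S"
    and r: "r \<in> carrier OO'" "r [^]\<^bsub>OO'\<^esub> n = mat 1" and s: "s \<in> carrier OO'" "s ** s = mat 1"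
    and srs: "s ** r ** s ** r = mat 1"
    and fixed: "r *v (\<chi> i. if i \<in> S then 1 else 0) = (\<chi> i. if i \<in> S then 1 else 0)"
      "s *v (\<chi> i. if i \<in> S then 1 else 0) = (\<chi> i. if i \<in> S then 1 else 0)"
    and inj: "\<And>m. m < n \<Longrightarrow> (r [^]\<^bsub>OO'\<^esub> m) *v v = v \<or> (r [^]\<^bsub>OO'\<^esub> m) *v v = - v \<Longrightarrow> m = 0"
      "\<And>m. m < n \<Longrightarrow> (r [^]\<^bsub>OO'\<^esub> m) *v (s *v v) \<noteq> v \<and> (r [^]\<^bsub>OO'\<^esub> m) *v (s *v v) \<noteq> - v"
    and card: "card (normal_tuples k) * (2 * n) = 96"
  shows "nodes (quartic (-1 / of_nat k)) \<in> orbits OO' P3 proj_action \<and>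
    card (nodes (quartic (-1 / of_nat k))) = card (normal_tuples k) \<and>
    (\<forall>P\<in>nodes (quartic (-1 / of_nat k)). fix_group P \<cong> dihedral_group n \<and> order (fix_group P) = 2 * n)"
proof -
  have n: "n > 0" using card by (cases n) auto
  let ?\<psi> = "\<lambda>(a, b). r [^]\<^bsub>OO'\<^esub> (a::int) \<otimes>\<^bsub>OO'\<^esub> (if b then s else \<one>\<^bsub>OO'\<^esub>)"
  have "s \<otimes>\<^bsub>OO'\<^esub> r \<otimes>\<^bsub>OO'\<^esub> s = inv\<^bsub>OO'\<^esub> r"
    using OO.inv_equality[of "s ** r ** s" r] r s srs OO.m_closed by (metis mult_OO' one_OO')
  then have hom: "?\<psi> \<in> hom (dihedral_group n) OO'"
    using r s by (intro OO.dihedral_hom) simp_all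
  have repr: "\<exists>m<n. ?\<psi> h = (r [^]\<^bsub>OO'\<^esub> m) ** (if snd h then s else mat 1) \<and> fst h = int m"
    if "h \<in> carrier (dihedral_group n)" for h
    using that by (intro exI[of _ "nat (fst h)"]) (auto simp: dihedral_group_def int_pow_int[symmetric])
  show ?thesis
    unfolding order_dihedral_group(1)[symmetric]
  proof (rule node_orbit[OF S group_dihedral_group[OF n] order_dihedral_group(2) hom])
    fix h assume h: "h \<in> carrier (dihedral_group n)"
    obtain m where m: "m < n" "?\<psi> h = (r [^]\<^bsub>OO'\<^esub> m) ** (if snd h then s else mat 1)" "fst h = int m"
      using repr[OF h] by blast
    show "complexify (?\<psi> h) *v indicator_vec S = indicator_vec S"
      unfolding m(2)
      by (rule complexify_indicator_vec)
         (simp add: matrix_vector_mul_assoc[symmetric] fixed nat_pow_OO'_vec)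
    assume "?\<psi> h = mat 1 \<or> ?\<psi> h = - mat 1"
    then have "?\<psi> h *v v = v \<or> ?\<psi> h *v v = - v"
      \<comment> \<open>The instance (0 - 1) v = 0 v - 1 v shows that the matrix -1 negates
        vectors.\<close>
      using matrix_vector_mult_diff_rdistrib[of 0 "mat 1" v] by auto
    then have "\<not> snd h \<and> m = 0"
      using inj[OF m(1)] unfolding m(2) by (auto simp: matrix_vector_mul_assoc[symmetric] split: if_splits)
    then show "h = \<one>\<^bsub>dihedral_group n\<^esub>"
      using m(3) by (cases h) (simp add: dihedral_group_def)
  qed (use card order_dihedral_group(1) in simp)
qed

lemma less_4_cases: "m < (4::nat) \<longleftrightarrow> m = 0 \<or> m = 1 \<or> m = 2 \<or> m = 3"
  and less_3_cases: "m < (3::nat) \<longleftrightarrow> m = 0 \<or> m = 1 \<or> m = 2"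
  by auto

lemma nat_pow_OO'_numeral:
  "r [^]\<^bsub>OO'\<^esub> (2::nat) = r ** r" "r [^]\<^bsub>OO'\<^esub> (3::nat) = r ** r ** r" "r [^]\<^bsub>OO'\<^esub> (4::nat) = r ** r ** r ** r"
  "r [^]\<^bsub>OO'\<^esub> (1::nat) = r" "r [^]\<^bsub>OO'\<^esub> (0::nat) = mat 1"
  by (simp_all add: numeral_eq_Suc)

lemmas vec_simps = matrix_eq matrix_vector_mul_assoc[symmetric] vec4_eq_iff signed_perm_vec
  Transposition.transpose_def

text \<open>On the last two coordinates the stabilizer of (1, 1, 0, 0) is the symmetry group of a
  square: r is a quarter turn, and s a reflection whose determinant is compensated by swapping the
  first two coordinates.\<close>

lemma nodes_quartic_half:
  "nodes (quartic (-1/2)) \<in> orbits OO' P3 proj_action \<and> card (nodes (quartic (-1/2))) = 12 \<and>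
    (\<forall>P\<in>nodes (quartic (-1/2)). fix_group P \<cong> dihedral_group 4 \<and> order (fix_group P) = 8)"
proof -
  define r where "r = signed_perm (Transposition.transpose (2::4) 3) (tuple4 1 1 1 (-1))"
  define s where "s = signed_perm (Transposition.transpose (0::4) 1) (tuple4 1 1 1 (-1))"
  have rv: "(r *v x) $ 0 = x$0" "(r *v x) $ 1 = x$1" "(r *v x) $ 2 = x$3" "(r *v x) $ 3 = - x$2" for x
    by (simp_all add: r_def vec_simps)
  have sv: "(s *v x) $ 0 = x$1" "(s *v x) $ 1 = x$0" "(s *v x) $ 2 = x$2" "(s *v x) $ 3 = - x$3" for x
    by (simp_all add: s_def vec_simps)
  note simps = nat_pow_OO'_numeral matrix_eq matrix_vector_mul_assoc[symmetric] vec4_eq_iff rv sv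
  have "nodes (quartic (-1 / of_nat 2)) \<in> orbits OO' P3 proj_action \<and>
    card (nodes (quartic (-1 / of_nat 2))) = card (normal_tuples 2) \<and>
    (\<forall>P\<in>nodes (quartic (-1 / of_nat 2)). fix_group P \<cong> dihedral_group 4 \<and> order (fix_group P) = 2 * 4)"
  \<comment> \<open>The entries 1, 2, 3, 4 have distinct nonzero absolute values, so a signed
    permutation matrix sending this vector to itself or its negative is \<plusminus>1.\<close>
  proof (rule node_orbit_dihedral[of "{0, 1}" _ 0 1 r _ s "quat 1 2 3 4"])
    show "r \<in> carrier OO'" "s \<in> carrier OO'"
      unfolding r_def s_def by (rule signed_perm_in_OO'; simp add: rotation_simps)+
    show "m = 0" if "m < 4" "(r [^]\<^bsub>OO'\<^esub> m) *v quat 1 2 3 4 = quat 1 2 3 4 \<or> (r [^]\<^bsub>OO'\<^esub> m) *v quat 1 2 3 4 = - quat 1 2 3 4" for m :: nat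
      using that unfolding less_4_cases by (elim disjE) (simp_all add: simps)
    show "(r [^]\<^bsub>OO'\<^esub> m) *v (s *v quat 1 2 3 4) \<noteq> quat 1 2 3 4 \<and> (r [^]\<^bsub>OO'\<^esub> m) *v (s *v quat 1 2 3 4) \<noteq> - quat 1 2 3 4" if "m < 4" for m :: nat
      using that unfolding less_4_cases by (elim disjE) (simp_all add: simps)
  qed (simp_all add: simps card_normal_tuples)
  then show ?thesis by (simp add: card_normal_tuples)
qed

text \<open>The permutations of the first three coordinates form D_3. The 3-cycle r has determinant
  one; the transposition s is corrected by a sign at the coordinate where (1, 1, 1, 0)
  vanishes.\<close>

lemma nodes_quartic_third:
  "nodes (quartic (-1/3)) \<in> orbits OO' P3 proj_action \<and> card (nodes (quartic (-1/3))) = 16 \<and>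
    (\<forall>P\<in>nodes (quartic (-1/3)). fix_group P \<cong> dihedral_group 3 \<and> order (fix_group P) = 6)"
proof -
  define r where "r = signed_perm (Transposition.transpose (0::4) 1 \<circ> Transposition.transpose 1 2) (\<lambda>_. 1)"
  define s where "s = signed_perm (Transposition.transpose (0::4) 1) (tuple4 1 1 1 (-1))"
  have rv: "(r *v x) $ 0 = x$1" "(r *v x) $ 1 = x$2" "(r *v x) $ 2 = x$0" "(r *v x) $ 3 = x$3" for x
    by (simp_all add: r_def vec_simps)
  have sv: "(s *v x) $ 0 = x$1" "(s *v x) $ 1 = x$0" "(s *v x) $ 2 = x$2" "(s *v x) $ 3 = - x$3" for x
    by (simp_all add: s_def vec_simps)
  note simps = nat_pow_OO'_numeral matrix_eq matrix_vector_mul_assoc[symmetric] vec4_eq_iff rv sv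
  have "nodes (quartic (-1 / of_nat 3)) \<in> orbits OO' P3 proj_action \<and>
    card (nodes (quartic (-1 / of_nat 3))) = card (normal_tuples 3) \<and>
    (\<forall>P\<in>nodes (quartic (-1 / of_nat 3)). fix_group P \<cong> dihedral_group 3 \<and> order (fix_group P) = 2 * 3)"
  proof (rule node_orbit_dihedral[of "{0, 1, 2}" _ 0 1 r _ s "quat 1 2 3 4"])
    show "r \<in> carrier OO'" "s \<in> carrier OO'"
      unfolding r_def s_def by (rule signed_perm_in_OO'; simp add: rotation_simps)+
    show "m = 0" if "m < 3" "(r [^]\<^bsub>OO'\<^esub> m) *v quat 1 2 3 4 = quat 1 2 3 4 \<or> (r [^]\<^bsub>OO'\<^esub> m) *v quat 1 2 3 4 = - quat 1 2 3 4" for m :: nat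
      using that unfolding less_3_cases by (elim disjE) (simp_all add: simps)
    show "(r [^]\<^bsub>OO'\<^esub> m) *v (s *v quat 1 2 3 4) \<noteq> quat 1 2 3 4 \<and> (r [^]\<^bsub>OO'\<^esub> m) *v (s *v quat 1 2 3 4) \<noteq> - quat 1 2 3 4" if "m < 3" for m :: nat
      using that unfolding less_3_cases by (elim disjE) (simp_all add: simps)
  qed (simp_all add: simps card_normal_tuples)
  then show ?thesis by (simp add: card_normal_tuples)
qed

section \<open>Alternating and symmetric fix groups\<close>

text \<open>\<open>sym_group 4\<close> and \<open>alt_group 4\<close> act on the natural numbers 1
  to 4, the matrices are indexed by type \<open>4\<close>; \<open>of_nat\<close> matches them and
  sends 4 to 0.\<close>

definition index_perm :: "(nat \<Rightarrow> nat) \<Rightarrow> 4 \<Rightarrow> 4" where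
  "index_perm = map_permutation {1..4} of_nat"

lemma bij_betw_of_nat_4: "bij_betw (of_nat :: nat \<Rightarrow> 4) {1..4} UNIV"
proof -
  have "{1..4::nat} = {1, 2, 3, 4}" by auto
  then show ?thesis
    unfolding bij_betw_def UNIV4 by (auto simp: numerals_mod_4)
qed

lemma inj_on_of_nat_4: "inj_on (of_nat :: nat \<Rightarrow> 4) {1..4}"
  using bij_betw_of_nat_4 by (simp add: bij_betw_def)

lemma bij_index_perm: "p permutes {1..4} \<Longrightarrow> bij (index_perm p)"
  using map_permutation_permutes[OF bij_betw_of_nat_4] unfolding index_perm_def permutes_UNIV_bij .

lemma index_perm_comp: "q permutes {1..4} \<Longrightarrow> index_perm (p \<circ> q) = index_perm p \<circ> index_perm q"
  unfolding index_perm_def by (rule map_permutation_compose'[OF inj_on_of_nat_4])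

lemma sign_index_perm: "p permutes {1..4} \<Longrightarrow> sign (index_perm p) = sign p"
  unfolding index_perm_def by (rule sign_map_permutation[OF inj_on_of_nat_4]) auto

lemma index_perm_eq_id: "p permutes {1..4} \<Longrightarrow> index_perm p = id \<Longrightarrow> p = id"
proof
  fix x assume p: "p permutes {1..4}" "index_perm p = id"
  show "p x = id x"
  proof (cases "x \<in> {1..4}")
    case True
    then have "of_nat (p x) = (of_nat x :: 4)"
      using map_permutation_apply[OF inj_on_of_nat_4 True, of p] p(2) by (simp add: index_perm_def)
    moreover have "p x \<in> {1..4}" using True permutes_in_image[OF p(1)] by blast
    ultimately show ?thesis using True inj_on_of_nat_4 by (simp add: inj_on_def)
  qed (use permutes_not_in[OF p(1)] in simp)
qed

text \<open>Taking inverses cancels the order reversal in products of signed permutation matrices,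
  so that the representations become homomorphisms.\<close>

lemma inv_index_perm_comp:
  assumes "p permutes {1..4}" "q permutes {1..4}"
  shows "inv' (index_perm (p \<circ> q)) = inv' (index_perm q) \<circ> inv' (index_perm p)"
  using bij_index_perm[OF assms(1)] bij_index_perm[OF assms(2)]
  by (simp add: index_perm_comp[OF assms(2)] o_inv_distrib)

lemma inv_index_perm_eq_id:
  assumes "p permutes {1..4}" "inv' (index_perm p) = id"
  shows "p = id"
  using assms bij_index_perm[OF assms(1)] by (metis index_perm_eq_id inv_id inv_inv_eq)

lemma sign_inv_index_perm: "p permutes {1..4} \<Longrightarrow> sign (inv' (index_perm p)) = sign p"
  using sign_inverse[of "index_perm p"] bij_index_perm[of p] sign_index_perm[of p] by (simp add: permutation_bij)

lemma bij_inv_index_perm: "p permutes {1..4} \<Longrightarrow> bij (inv' (index_perm p))"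
  using bij_index_perm by (simp add: bij_imp_bij_inv)

definition perm_matrix :: "(4 \<Rightarrow> 4) \<Rightarrow> real^4^4" where
  "perm_matrix \<sigma> = signed_perm \<sigma> (\<lambda>_. 1)"

lemma perm_matrix_mult: "perm_matrix \<sigma> ** perm_matrix \<tau> = perm_matrix (\<tau> \<circ> \<sigma>)"
  by (simp add: perm_matrix_def signed_perm_mult)

lemma perm_matrix_vec: "(perm_matrix \<sigma> *v x) $ i = x $ \<sigma> i"
  by (simp add: perm_matrix_def signed_perm_vec)

lemma perm_matrix_id: "perm_matrix id = mat 1"
  by (simp add: perm_matrix_def signed_perm_id)

lemma perm_matrix_eq_one: "perm_matrix \<sigma> = mat 1 \<Longrightarrow> \<sigma> = id"
  unfolding perm_matrix_id[symmetric] unfolding perm_matrix_def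
  by (rule signed_perm_inject(1)[rotated]) auto

lemma perm_matrix_nth: "perm_matrix \<sigma> $ i $ j = (if j = \<sigma> i then 1 else 0)"
  by (simp add: perm_matrix_def signed_perm_def)

lemma perm_matrix_neq_uminus_one: "perm_matrix \<sigma> \<noteq> - mat 1"
proof
  assume "perm_matrix \<sigma> = - mat 1"
  then have "perm_matrix \<sigma> $ 0 $ 0 = - (mat 1 :: real^4^4) $ 0 $ 0" by simp
  then show False by (simp add: perm_matrix_nth mat_def split: if_splits)
qed

text \<open>A signed permutation matrix fixing (1, 1, 1, 1) has no negative entry, and determinant
  one then selects the even permutations.\<close>

lemma nodes_quartic_quarter:
  "nodes (quartic (-1/4)) \<in> orbits OO' P3 proj_action \<and> card (nodes (quartic (-1/4))) = 8 \<and>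
    (\<forall>P\<in>nodes (quartic (-1/4)). fix_group P \<cong> alt_group 4 \<and> order (fix_group P) = 12)"
proof -
  have carrier: "carrier (alt_group 4) = {p. p permutes {1..4} \<and> evenperm p}"
    using alt_group_carrier by blast
  have "2 * card (carrier (alt_group 4)) = fact 4"
    by (rule alt_group_card_carrier) simp
  then have order: "order (alt_group 4) = 12" by (simp add: order_def fact_numeral)
  have "nodes (quartic (-1 / of_nat 4)) \<in> orbits OO' P3 proj_action \<and>
    card (nodes (quartic (-1 / of_nat 4))) = card (normal_tuples 4) \<and>
    (\<forall>P\<in>nodes (quartic (-1 / of_nat 4)). fix_group P \<cong> alt_group 4 \<and> order (fix_group P) = order (alt_group 4))"
  proof (rule node_orbit[of UNIV _ 0 1 _ "\<lambda>p. perm_matrix (inv' (index_perm p))"])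
    show "group (alt_group 4)" by (rule alt_group_is_group)
    show "finite (carrier (alt_group 4))" using order unfolding order_def by (intro card_ge_0_finite) simp
    show "(\<lambda>p. perm_matrix (inv' (index_perm p))) \<in> hom (alt_group 4) OO'"
    proof (rule homI)
      fix p assume "p \<in> carrier (alt_group 4)"
      then have "p permutes {1..4}" "sign p = 1" by (simp_all add: carrier sign_def)
      then show "perm_matrix (inv' (index_perm p)) \<in> carrier OO'"
        unfolding perm_matrix_def by (intro signed_perm_in_OO') (simp_all add: sign_inv_index_perm bij_inv_index_perm)
    qed (simp add: carrier alt_group_mult inv_index_perm_comp perm_matrix_mult)
    show "complexify (perm_matrix (inv' (index_perm p))) *v indicator_vec UNIV = indicator_vec UNIV" for p
      by (rule complexify_indicator_vec) (simp add: vec_eq_iff perm_matrix_vec)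
    fix p assume p: "p \<in> carrier (alt_group 4)"
      "perm_matrix (inv' (index_perm p)) = mat 1 \<or> perm_matrix (inv' (index_perm p)) = - mat 1"
    show "p = \<one>\<^bsub>alt_group 4\<^esub>"
      using p inv_index_perm_eq_id perm_matrix_eq_one perm_matrix_neq_uminus_one by (auto simp: carrier alt_group_one)
  qed (simp_all add: order card_normal_tuples)
  then show ?thesis by (simp add: order card_normal_tuples)
qed

text \<open>Half of a Hadamard matrix; it carries the line through \<open>(1, 1, 1, 1)\<close>, which all
  permutation matrices fix, to the first coordinate axis.\<close>

definition hadamard :: "real^4^4" where
  "hadamard = matrix (\<lambda>x. quat ((x$0 + x$1 + x$2 + x$3) / 2) ((x$0 + x$1 - x$2 - x$3) / 2)
     ((x$0 - x$1 + x$2 - x$3) / 2) ((x$0 - x$1 - x$2 + x$3) / 2))"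

lemma hadamard_vec:
  "hadamard *v x = quat ((x$0 + x$1 + x$2 + x$3) / 2) ((x$0 + x$1 - x$2 - x$3) / 2)
     ((x$0 - x$1 + x$2 - x$3) / 2) ((x$0 - x$1 - x$2 + x$3) / 2)"
  unfolding hadamard_def
  by (rule matrix_works) (auto intro!: linearI simp: linear_matrix_vector_mul_eq vec4_eq_iff algebra_simps add_divide_distrib diff_divide_distrib)

lemma hadamard_square: "hadamard ** hadamard = mat 1"
  by (simp add: matrix_eq matrix_vector_mul_assoc[symmetric] hadamard_vec vec4_eq_iff field_simps)

text \<open>Minus the reflection in the hyperplane orthogonal to \<open>(1, 1, 1, 1)\<close>.\<close>

definition half_turn :: "real^4^4" where
  "half_turn = (\<chi> i j. 1/2) - mat 1"

lemma half_turn_vec: "(half_turn *v x) $ i = sum (($) x) UNIV / 2 - x $ i"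
  by (simp add: half_turn_def matrix_vector_mult_diff_rdistrib)
     (simp add: matrix_vector_mult_def sum4 add_divide_distrib)

lemma half_turn_square: "half_turn ** half_turn = mat 1"
  by (simp add: matrix_eq matrix_vector_mul_assoc[symmetric] half_turn_vec vec4_eq_iff sum4 field_simps)

text \<open>Permuting the coordinates preserves their sum.\<close>

lemma half_turn_commute: "bij \<sigma> \<Longrightarrow> half_turn ** perm_matrix \<sigma> = perm_matrix \<sigma> ** half_turn"
proof -
  assume "bij \<sigma>"
  then have "(\<Sum>i\<in>UNIV. x $ \<sigma> i) = sum (($) x) UNIV" for x :: "real^4"
    by (rule sum.reindex_bij_betw)
  then show ?thesis
    by (simp add: matrix_eq matrix_vector_mul_assoc[symmetric] vec_eq_iff half_turn_vec perm_matrix_vec)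
qed

text \<open>Odd permutation matrices have determinant -1, and so has \<open>half_turn\<close>, which
  fixes (1, 1, 1, 1) and negates its orthogonal hyperplane; the product has determinant one.\<close>

definition twisted_perm :: "(4 \<Rightarrow> 4) \<Rightarrow> real^4^4" where
  "twisted_perm \<sigma> = (if evenperm \<sigma> then perm_matrix \<sigma> else half_turn ** perm_matrix \<sigma>)"

lemma twisted_perm_mult:
  assumes "bij \<sigma>" "bij \<tau>"
  shows "twisted_perm \<sigma> ** twisted_perm \<tau> = twisted_perm (\<tau> \<circ> \<sigma>)"
proof -
  have "evenperm (\<tau> \<circ> \<sigma>) \<longleftrightarrow> (evenperm \<tau> \<longleftrightarrow> evenperm \<sigma>)"
    using assms by (simp add: evenperm_comp permutation_bij)
  moreover have "perm_matrix \<sigma> ** (half_turn ** perm_matrix \<tau>) = half_turn ** perm_matrix (\<tau> \<circ> \<sigma>)"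
    using half_turn_commute[OF assms(1)] by (simp add: matrix_mul_assoc perm_matrix_mult[symmetric])
  moreover have "half_turn ** perm_matrix \<sigma> ** (half_turn ** perm_matrix \<tau>) = perm_matrix (\<tau> \<circ> \<sigma>)"
    using calculation(2) by (metis matrix_mul_assoc half_turn_square matrix_mul_lid)
  moreover have "half_turn ** perm_matrix \<sigma> ** perm_matrix \<tau> = half_turn ** perm_matrix (\<tau> \<circ> \<sigma>)"
    by (simp add: matrix_mul_assoc[symmetric] perm_matrix_mult)
  ultimately show ?thesis
    by (simp add: twisted_perm_def perm_matrix_mult)
qed

text \<open>\<open>hadamard\<close> sends the axes to the vectors (1, d)/2, where d runs over one
  end of each space diagonal of the cube in the last three coordinates. Permuting these ends gives
  the symmetries of a tetrahedron; the twist negates the improper ones, which yields the rotations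
  of the cube.\<close>

definition cube_rotation :: "(4 \<Rightarrow> 4) \<Rightarrow> real^4^4" where
  "cube_rotation \<sigma> = hadamard ** twisted_perm \<sigma> ** hadamard"

lemma cube_rotation_mult:
  assumes "bij \<sigma>" "bij \<tau>"
  shows "cube_rotation \<sigma> ** cube_rotation \<tau> = cube_rotation (\<tau> \<circ> \<sigma>)"
proof -
  have "cube_rotation \<sigma> ** cube_rotation \<tau>
      = hadamard ** twisted_perm \<sigma> ** (hadamard ** hadamard) ** twisted_perm \<tau> ** hadamard"
    by (simp add: cube_rotation_def matrix_mul_assoc)
  also have "\<dots> = hadamard ** (twisted_perm \<sigma> ** twisted_perm \<tau>) ** hadamard"
    by (simp add: hadamard_square matrix_mul_assoc)
  finally show ?thesis
    by (simp add: twisted_perm_mult[OF assms] cube_rotation_def)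
qed

text \<open>Swapping two diagonals is a half-turn of the cube about an axis through midpoints of
  opposite edges. Transpositions generate, so these six matrices settle membership for all
  permutations.\<close>

lemma cube_rotation_transpose:
  assumes "a \<noteq> b"
  shows "cube_rotation (Transposition.transpose a b) \<in> carrier OO'"
proof -
  let ?t = "Transposition.transpose :: 4 \<Rightarrow> _"
  have odd: "cube_rotation (?t a b) = hadamard ** (half_turn ** perm_matrix (?t a b)) ** hadamard" if "a \<noteq> b" for a b
    using that by (simp add: cube_rotation_def twisted_perm_def evenperm_swap)
  note simps = matrix_eq matrix_vector_mul_assoc[symmetric] vec4_eq_iff hadamard_vec half_turn_vec
    perm_matrix_vec signed_perm_vec sum4 Transposition.transpose_def
  have eqs: "cube_rotation (?t 0 1) = signed_perm (?t 2 3) (tuple4 1 (-1) 1 1)"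
    "cube_rotation (?t 0 2) = signed_perm (?t 1 3) (tuple4 1 1 (-1) 1)"
    "cube_rotation (?t 0 3) = signed_perm (?t 1 2) (tuple4 1 1 1 (-1))"
    "cube_rotation (?t 1 2) = signed_perm (?t 1 2) (tuple4 1 (-1) (-1) (-1))"
    "cube_rotation (?t 1 3) = signed_perm (?t 1 3) (tuple4 1 (-1) (-1) (-1))"
    "cube_rotation (?t 2 3) = signed_perm (?t 2 3) (tuple4 1 (-1) (-1) (-1))"
    by (subst odd, simp, simp add: simps, simp add: field_simps)+
  have "cube_rotation (?t 0 1) \<in> carrier OO'" "cube_rotation (?t 0 2) \<in> carrier OO'"
    "cube_rotation (?t 0 3) \<in> carrier OO'" "cube_rotation (?t 1 2) \<in> carrier OO'"
    "cube_rotation (?t 1 3) \<in> carrier OO'" "cube_rotation (?t 2 3) \<in> carrier OO'"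
    unfolding eqs by (rule signed_perm_in_OO'; simp add: rotation_simps)+
  then show ?thesis
    using assms by (cases a rule: cases4; cases b rule: cases4) (simp_all add: transpose_commute)
qed

lemma cube_rotation_id: "cube_rotation id = mat 1"
  by (simp add: cube_rotation_def twisted_perm_def perm_matrix_id hadamard_square)

lemma cube_rotation_in_OO':
  assumes "bij \<sigma>"
  shows "cube_rotation \<sigma> \<in> carrier OO'"
proof -
  have "\<sigma> permutes UNIV" using assms by (simp add: permutes_UNIV_bij)
  moreover have "finite (UNIV :: 4 set)" by simp
  ultimately show ?thesis
  proof (induction rule: permutes_induct)
    case id
    show ?case using OO.one_closed by (simp add: cube_rotation_id[unfolded id_def] id_def)
  next
    case (swap a b p)
    have "bij p" using swap.hyps by (simp add: permutes_UNIV_bij)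
    then have "cube_rotation (Transposition.transpose a b \<circ> p) = cube_rotation p ** cube_rotation (Transposition.transpose a b)"
      by (simp add: cube_rotation_mult)
    with OO.m_closed[OF swap.IH cube_rotation_transpose[OF \<open>a \<noteq> b\<close>]] show ?case by (simp only: mult_OO')
  qed
qed

lemma cube_rotation_trivial:
  assumes "cube_rotation \<sigma> = mat 1 \<or> cube_rotation \<sigma> = - mat 1"
  shows "\<sigma> = id"
proof -
  have "hadamard ** cube_rotation \<sigma> ** hadamard = twisted_perm \<sigma>"
    unfolding cube_rotation_def by (metis hadamard_square matrix_mul_assoc matrix_mul_lid matrix_mul_rid)
  then have tw: "twisted_perm \<sigma> = mat 1 \<or> twisted_perm \<sigma> = - mat 1"
    using assms by (auto simp: matrix_mul_uminus hadamard_square)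
  show ?thesis
  proof (cases "evenperm \<sigma>")
    case True
    then have "perm_matrix \<sigma> = mat 1 \<or> perm_matrix \<sigma> = - mat 1"
      using tw by (simp add: twisted_perm_def)
    then show ?thesis using perm_matrix_eq_one perm_matrix_neq_uminus_one by blast
  next
    case False
    then have "half_turn ** perm_matrix \<sigma> = mat 1 \<or> half_turn ** perm_matrix \<sigma> = - mat 1"
      using tw by (simp add: twisted_perm_def)
    then have "half_turn ** (half_turn ** perm_matrix \<sigma>) = half_turn \<or> half_turn ** (half_turn ** perm_matrix \<sigma>) = - half_turn"
      by (auto simp: matrix_mul_uminus)
    then have "perm_matrix \<sigma> = half_turn \<or> perm_matrix \<sigma> = - half_turn"
      by (simp add: matrix_mul_assoc half_turn_square)
    \<comment> \<open>The corner entry of \<open>half_turn\<close> is -1/2, whereas a permutation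
      matrix has only 0 and 1.\<close>
    then have "perm_matrix \<sigma> $ 0 $ 0 = half_turn $ 0 $ 0 \<or> perm_matrix \<sigma> $ 0 $ 0 = - half_turn $ 0 $ 0"
      by auto
    then have False by (auto simp: perm_matrix_nth half_turn_def mat_def split: if_splits)
    then show ?thesis ..
  qed
qed

lemma quat_const: "quat c c c c $ i = c"
  by (cases i rule: cases4) simp_all

text \<open>The node is the first coordinate axis, the image under \<open>hadamard\<close> of the
  line that all the twisted permutations fix.\<close>

lemma nodes_quartic_one:
  "nodes (quartic (-1)) \<in> orbits OO' P3 proj_action \<and> card (nodes (quartic (-1))) = 4 \<and>
    (\<forall>P\<in>nodes (quartic (-1)). fix_group P \<cong> sym_group 4 \<and> order (fix_group P) = 24)"
proof -
  have carrier: "carrier (sym_group 4) = {p. p permutes {1..4}}"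
    using sym_group_carrier by blast
  have order: "order (sym_group 4) = 24" by (simp add: order_def sym_group_card_carrier fact_numeral)
  have "nodes (quartic (-1 / of_nat 1)) \<in> orbits OO' P3 proj_action \<and>
    card (nodes (quartic (-1 / of_nat 1))) = card (normal_tuples 1) \<and>
    (\<forall>P\<in>nodes (quartic (-1 / of_nat 1)). fix_group P \<cong> sym_group 4 \<and> order (fix_group P) = order (sym_group 4))"
  proof (rule node_orbit[of "{0}" _ 2 3 _ "\<lambda>p. cube_rotation (inv' (index_perm p))"])
    show "group (sym_group 4)" by (rule sym_group_is_group)
    show "finite (carrier (sym_group 4))" using order unfolding order_def by (intro card_ge_0_finite) simp
    show "(\<lambda>p. cube_rotation (inv' (index_perm p))) \<in> hom (sym_group 4) OO'"
      by (rule homI)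
         (simp_all add: carrier sym_group_mult inv_index_perm_comp cube_rotation_mult bij_inv_index_perm
            cube_rotation_in_OO')
    show "complexify (cube_rotation (inv' (index_perm p))) *v indicator_vec {0} = indicator_vec {0}" for p
      by (rule complexify_indicator_vec)
         (simp add: cube_rotation_def twisted_perm_def matrix_vector_mul_assoc[symmetric] hadamard_vec
           vec4_eq_iff perm_matrix_vec half_turn_vec sum4 quat_const)
    fix p assume "p \<in> carrier (sym_group 4)"
      "cube_rotation (inv' (index_perm p)) = mat 1 \<or> cube_rotation (inv' (index_perm p)) = - mat 1"
    then show "p = \<one>\<^bsub>sym_group 4\<^esub>"
      using cube_rotation_trivial inv_index_perm_eq_id by (auto simp: carrier sym_group_one)
  qed (simp_all add: order card_normal_tuples card_normal_tuples(1)[unfolded One_nat_def])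
  then show ?thesis by (simp add: order card_normal_tuples card_normal_tuples(1)[unfolded One_nat_def])
qed

theorem lemma5p2:
  shows
    "(nodes (quartic (-1)) \<in> orbits OO' P3 proj_action \<and>
      card (nodes (quartic (-1))) = 4 \<and>
      (\<forall>P\<in>nodes (quartic (-1)).
         fix_group P \<cong> sym_group 4 \<and> order (fix_group P) = 24)) \<and>
     (nodes (quartic (-1/2)) \<in> orbits OO' P3 proj_action \<and>
      card (nodes (quartic (-1/2))) = 12 \<and>
      (\<forall>P\<in>nodes (quartic (-1/2)).
         fix_group P \<cong> dihedral_group 4 \<and> order (fix_group P) = 8)) \<and>
     (nodes (quartic (-1/3)) \<in> orbits OO' P3 proj_action \<and>
      card (nodes (quartic (-1/3))) = 16 \<and>
      (\<forall>P\<in>nodes (quartic (-1/3)).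
         fix_group P \<cong> dihedral_group 3 \<and> order (fix_group P) = 6)) \<and>
     (nodes (quartic (-1/4)) \<in> orbits OO' P3 proj_action \<and>
      card (nodes (quartic (-1/4))) = 8 \<and>
      (\<forall>P\<in>nodes (quartic (-1/4)).
         fix_group P \<cong> alt_group 4 \<and> order (fix_group P) = 12))"
  by (intro conjI[OF nodes_quartic_one] conjI[OF nodes_quartic_half] conjI[OF nodes_quartic_third]
      nodes_quartic_quarter)

end
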